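(* Let $\mathcal{P}=\mathrm{grp}\langle X,\ \omega:R\to F(X)\rangle$ be a group presentation of a group $G$, with quotient morphism $\phi:F(X)\to G$, and suppose $\mathcal{P}$ has a complete logged rewrite system $\mathcal{L}(\mathcal{P})$. Let $\sigma:G\to F(X)$ be the section of $\phi$ sending each $g\in G$ to (the free group element represented by) the unique $\mathcal{R}_{\mathcal{L}}$-irreducible word in $\bar X^*$ representing $g$. Then the logged information of $\mathcal{L}(\mathcal{P})$ determines a groupoid morphism $k_1:F(\widetilde X)\to C(R)$, namely: for each edge $[g,x]$ of the Cayley graph, $k_1[g,x]$ is an element of $C(R)$ of the form $[L(w)]$, where $w=\mu_X\big((\sigma g)\,x\,(\sigma(g(\phi x)))^{-1}\big)$ and $L(w)$ is a log Y-sequence of a logged reduction of $w$ with respect to $\mathcal{L}(\mathcal{P})$ (taken to be $[\lambda_{\bar Y}]$ whenever possible), extended to paths multiplicatively; it satisfies $\delta_2 k_1[g,x]=(\sigma g)\,x\,(\sigma(g(\phi x)))^{-1}$ for all $g\in G$, $x\in X$. For this $k_1$, the elements $$\iota_{[g,\rho]}=(\rho^-)^{(\sigma g)^{-1}}\,\big(k_1[g,\omega\rho]\big)\in C(R),\qquad g\in G,\ \rho\in R,$$ form a complete set of generators for $\Pi_2(\mathcal{P})=\ker\delta_2$ as a $\mathbb{Z}G$-module.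
   Context: Notation. For a set $A$, $F(A)$ is the free group and $A^*$ the free monoid on $A$, with empty word $\lambda_A$. Put $\bar A=\{a^+:a\in A\}\sqcup\{a^-:a\in A\}$, with $(a^+)^-=a^-$, $(a^-)^-=a^+$, extended to words by $w^-$ = formal inverse. $\mu_A:F(A)\to\bar A^*/\{a^+a^-=\lambda=a^-a^+\}$ is the isomorphism $a\mapsto a^+$, $a^{-1}\mapsto a^-$; words in $\bar X^*$ and elements of $F(X)$ are identified via $\mu_X$ where convenient. A presentation $\mathcal{P}=\mathrm{grp}\langle X,\omega:R\to F(X)\rangle$ has generators $X$, relator labels $R$, and $\omega$ giving each relator as a word; $G=F(X)/N$ where $N$ is the normal closure of $\omega(R)$, $\phi:F(X)\to G$ the quotient. Let $\bar\omega\rho=\mu_X(\omega\rho)$. Crossed module of consequences. Let $Y=R\times F(X)$; elements of $\bar Y$ are written $(\rho^\epsilon)^u$ ($\rho\in R$, $u\in F(X)$, $\epsilon\in\{+,-\}$), and elements of $\bar Y^*$ are Y-sequences. $F(X)$ acts by $((\rho^\epsilon)^u)^v=(\rho^\epsilon)^{uv}$, extended to $\bar Y^*$ termwise. $\delta:\bar Y^*\to F(X)$ is the monoid morphism with $\delta((\rho^+)^u)=u^{-1}(\omega\rho)u$, $\delta((\rho^-)^u)=u^{-1}(\omega\rho)^{-1}u$. The Peiffer congruence $=_P$ on $\bar Y^*$ is generated by $(y^-zy^+,\ z^{\delta y})$ and $(y^+y^-,\lambda_{\bar Y})$ for $y,z\in\bar Y$. $C(R)=\bar Y^*/{=_P}$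 (a group, the free crossed $F(X)$-module on $\omega$), with $[c]^u=[c^u]$ and $\delta_2[c]=\delta c$. $\Pi_2(\mathcal{P})=\ker\delta_2$, the module of identities among relations, a $\mathbb{Z}G$-module. Logged rewrite systems. A logged rewrite system for $\mathcal{P}$ is a finite set of triples $(l_i,c_i,r_i)$ with $l_i,r_i\in\bar X^*$, $c_i\in\bar Y^*$, such that $\mathcal{R}_{\mathcal L}=\{(l_i,r_i)\}$ is a string rewriting system for $G$ on $\bar X$ (i.e. $\bar X^*$ modulo the congruence generated by $\mathcal{R}_{\mathcal L}$ is isomorphic to $G$ via the natural map) and $l_i=\mu_X(\delta c_i)\,r_i$. It is complete if $\mathcal{R}_{\mathcal L}$ is a complete (Noetherian and confluent) rewriting system. A logged reduction of $w\in\bar X^*$: start with $z_0=w$, $L_0=\lambda_{\bar Y}$; while $z_i=ulv$ for some rule $(l,c,r)$ and $u,v\in\bar X^*$, set $z_{i+1}=urv$ and $L_{i+1}=L_i\,c^{u^{-1}}$; on termination output the irreducible word $I(w)$ and log $L(w)$, so that $w=\delta(L(w))\,I(w)$. Cayley graph and groupoid. $\widetilde X$ is the Cayley graph of $\mathcal{P}$: vertices are the elements of $G$, edges $[g,x]:g\to g(\phi x)$ for $g\in G$, $x\in X$. $F(\widetilde X)$ is the free groupoid on $\widetilde X$, whose paths are written $[g,u]:g\to g(\phi u)$ for $u\in F(X)$ (the path from $g$ following the letters of $u$, traversing edges backwards for inverse letters). $C(R)$ is regarded as a one-object groupoid, and $k_1[g,\omega\rho]$ is the image of the closed path $[g,\omega\rho]$.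 *)

theory Defs
  imports
    "HOL-Algebra.Algebra"
    "HOL-Library.Confluence"
    "Graph_Theory.Arc_Walk"
begin

section \<open>Words, string rewriting and presented monoids\<close>

text \<open>The letters of the doubled alphabet: \<open>(a, True)\<close> is \<open>a\<^sup>+\<close> and \<open>(a, False)\<close> is \<open>a\<^sup>-\<close>.\<close>

definition bar :: "'a set \<Rightarrow> ('a \<times> bool) set" where
  "bar A = A \<times> UNIV"

definition letter_inv :: "'a \<times> bool \<Rightarrow> 'a \<times> bool" where
  "letter_inv y = (fst y, \<not> snd y)"

definition rstep :: "'a set \<Rightarrow> ('a list \<times> 'a list) set \<Rightarrow> 'a list \<Rightarrow> 'a list \<Rightarrow> bool" where
  "rstep A S z z' \<longleftrightarrow>
     (\<exists>u\<in>lists A. \<exists>v\<in>lists A. \<exists>(l, r)\<in>S. z = u @ l @ v \<and> z' = u @ r @ v)"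

definition irreducible_word :: "'a set \<Rightarrow> ('a list \<times> 'a list) set \<Rightarrow> 'a list \<Rightarrow> bool" where
  "irreducible_word A S z \<longleftrightarrow> (\<nexists>z'. rstep A S z z')"

definition complete_rewriting :: "'a set \<Rightarrow> ('a list \<times> 'a list) set \<Rightarrow> bool" where
  "complete_rewriting A S \<longleftrightarrow> wfp (rstep A S)\<inverse>\<inverse> \<and> confluentp (rstep A S)"

definition word_class :: "'a set \<Rightarrow> ('a list \<times> 'a list) set \<Rightarrow> 'a list \<Rightarrow> 'a list set" where
  "word_class A S w = {w'. equivclp (rstep A S) w w'}"

definition presented_monoid ::
    "'a set \<Rightarrow> ('a list \<times> 'a list) set \<Rightarrow> 'a list set monoid" where
  "presented_monoid A S =
     \<lparr>carrier = word_class A S ` lists A,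
      monoid.mult = (\<lambda>p q. \<Union>u\<in>p. \<Union>v\<in>q. word_class A S (u @ v)),
      one = word_class A S []\<rparr>"

text \<open>The free group on \<open>A\<close> is realised as the monoid of words over \<open>bar A\<close> modulo cancellation,
  so the identification of \<open>F(A)\<close> with this quotient is the identity map, and the
  words representing a free group element are literally its members.\<close>

definition cancel_rules :: "'a set \<Rightarrow> (('a \<times> bool) list \<times> ('a \<times> bool) list) set" where
  "cancel_rules A = (\<lambda>y. ([y, letter_inv y], [])) ` bar A"

type_synonym 'a free_elt = "('a \<times> bool) list set"

abbreviation free_group :: "'a set \<Rightarrow> 'a free_elt monoid" where
  "free_group A \<equiv> presented_monoid (bar A) (cancel_rules A)"

abbreviation free_class :: "'a set \<Rightarrow> ('a \<times> bool) list \<Rightarrow> 'a free_elt" where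
  "free_class A \<equiv> word_class (bar A) (cancel_rules A)"


section \<open>Group presentations\<close>

record ('x, 'r) grp_presentation =
  gens :: "'x set"
  labels :: "'r set"
  relator :: "'r \<Rightarrow> 'x free_elt"

definition is_presentation :: "('x, 'r) grp_presentation \<Rightarrow> bool" where
  "is_presentation P \<longleftrightarrow> relator P \<in> labels P \<rightarrow> carrier (free_group (gens P))"

abbreviation FX :: "('x, 'r) grp_presentation \<Rightarrow> 'x free_elt monoid" where
  "FX P \<equiv> free_group (gens P)"

abbreviation X_class :: "('x, 'r) grp_presentation \<Rightarrow> ('x \<times> bool) list \<Rightarrow> 'x free_elt" where
  "X_class P \<equiv> free_class (gens P)"

abbreviation gen :: "('x, 'r) grp_presentation \<Rightarrow> 'x \<Rightarrow> 'x free_elt" where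
  "gen P x \<equiv> X_class P [(x, True)]"

definition relator_closure :: "('x, 'r) grp_presentation \<Rightarrow> 'x free_elt set" where
  "relator_closure P = \<Inter>{N. N \<lhd> FX P \<and> relator P ` labels P \<subseteq> N}"

definition grp_of :: "('x, 'r) grp_presentation \<Rightarrow> 'x free_elt set monoid" where
  "grp_of P = FX P Mod relator_closure P"

definition quot_map :: "('x, 'r) grp_presentation \<Rightarrow> 'x free_elt \<Rightarrow> 'x free_elt set" where
  "quot_map P u = relator_closure P #>\<^bsub>FX P\<^esub> u"


section \<open>The crossed module of consequences and the identities among relations\<close>

text \<open>The letter \<open>((\<rho>, u), s)\<close> is the paper's \<open>(\<rho>\<^sup>+)\<^sup>u\<close> or \<open>(\<rho>\<^sup>-)\<^sup>u\<close> according to the sign \<open>s\<close>.\<close>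

type_synonym ('x, 'r) Y_letter = "('r \<times> 'x free_elt) \<times> bool"
type_synonym ('x, 'r) C_elt = "('x, 'r) Y_letter list set"

abbreviation Ybar :: "('x, 'r) grp_presentation \<Rightarrow> ('x, 'r) Y_letter set" where
  "Ybar P \<equiv> bar (labels P \<times> carrier (FX P))"

fun Y_act :: "('x, 'r) grp_presentation \<Rightarrow> ('x, 'r) Y_letter \<Rightarrow> 'x free_elt \<Rightarrow> ('x, 'r) Y_letter" where
  "Y_act P ((\<rho>, u), s) v = ((\<rho>, u \<otimes>\<^bsub>FX P\<^esub> v), s)"

definition Yseq_act ::
    "('x, 'r) grp_presentation \<Rightarrow> ('x, 'r) Y_letter list \<Rightarrow> 'x free_elt \<Rightarrow> ('x, 'r) Y_letter list" where
  "Yseq_act P c v = map (\<lambda>y. Y_act P y v) c"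

fun delta_letter :: "('x, 'r) grp_presentation \<Rightarrow> ('x, 'r) Y_letter \<Rightarrow> 'x free_elt" where
  "delta_letter P ((\<rho>, u), s) =
     inv\<^bsub>FX P\<^esub> u \<otimes>\<^bsub>FX P\<^esub> (if s then relator P \<rho> else inv\<^bsub>FX P\<^esub> (relator P \<rho>)) \<otimes>\<^bsub>FX P\<^esub> u"

definition delta :: "('x, 'r) grp_presentation \<Rightarrow> ('x, 'r) Y_letter list \<Rightarrow> 'x free_elt" where
  "delta P c = foldr (\<lambda>y a. delta_letter P y \<otimes>\<^bsub>FX P\<^esub> a) c \<one>\<^bsub>FX P\<^esub>"

definition peiffer_rules ::
    "('x, 'r) grp_presentation \<Rightarrow> (('x, 'r) Y_letter list \<times> ('x, 'r) Y_letter list) set" where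
  "peiffer_rules P =
     {([letter_inv y, z, y], [Y_act P z (delta_letter P y)]) | y z. y \<in> Ybar P \<and> z \<in> Ybar P}
     \<union> {([y, letter_inv y], []) | y. y \<in> Ybar P}"

abbreviation C_class :: "('x, 'r) grp_presentation \<Rightarrow> ('x, 'r) Y_letter list \<Rightarrow> ('x, 'r) C_elt" where
  "C_class P \<equiv> word_class (Ybar P) (peiffer_rules P)"

definition CR :: "('x, 'r) grp_presentation \<Rightarrow> ('x, 'r) C_elt monoid" where
  "CR P = presented_monoid (Ybar P) (peiffer_rules P)"

definition C_act :: "('x, 'r) grp_presentation \<Rightarrow> ('x, 'r) C_elt \<Rightarrow> 'x free_elt \<Rightarrow> ('x, 'r) C_elt" where
  "C_act P k u = (\<Union>c\<in>k. C_class P (Yseq_act P c u))"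

definition delta2 :: "('x, 'r) grp_presentation \<Rightarrow> ('x, 'r) C_elt \<Rightarrow> 'x free_elt" where
  "delta2 P k = the_elem (delta P ` k)"

definition Pi2 :: "('x, 'r) grp_presentation \<Rightarrow> ('x, 'r) C_elt monoid" where
  "Pi2 P = (CR P)\<lparr>carrier := kernel (CR P) (FX P) (delta2 P)\<rparr>"

text \<open>On \<open>Pi2\<close> the relator closure acts trivially, so the action of \<open>g\<close>, a coset in \<open>F(X)\<close>, is
  that of any of its members. The group ring elements are the finitely supported integer-valued
  functions on \<open>G\<close>; as the abelian group \<open>Pi2\<close> is written multiplicatively, the scalar multiple of
  \<open>k\<close> by \<open>\<Sum>\<^sub>g a\<^sub>g g\<close> is the product of the \<open>a\<^sub>g\<close>-th powers of the \<open>k\<^sup>g\<close>. It is a right module.\<close>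

definition Pi2_act ::
    "('x, 'r) grp_presentation \<Rightarrow> ('x, 'r) C_elt \<Rightarrow> 'x free_elt set \<Rightarrow> ('x, 'r) C_elt" where
  "Pi2_act P k g = the_elem (C_act P k ` g)"

definition int_group_ring :: "('g, 'm) monoid_scheme \<Rightarrow> ('g \<Rightarrow> int) set" where
  "int_group_ring G = {a. finite {g. a g \<noteq> 0} \<and> {g. a g \<noteq> 0} \<subseteq> carrier G}"

definition Pi2_scale ::
    "('x, 'r) grp_presentation \<Rightarrow> ('x, 'r) C_elt \<Rightarrow> ('x free_elt set \<Rightarrow> int) \<Rightarrow> ('x, 'r) C_elt" where
  "Pi2_scale P k a = (\<Otimes>\<^bsub>Pi2 P\<^esub>g\<in>{g. a g \<noteq> 0}. Pi2_act P k g [^]\<^bsub>Pi2 P\<^esub> a g)"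

definition Pi2_submodule :: "('x, 'r) grp_presentation \<Rightarrow> ('x, 'r) C_elt set \<Rightarrow> bool" where
  "Pi2_submodule P M \<longleftrightarrow>
     subgroup M (Pi2 P) \<and> (\<forall>k\<in>M. \<forall>a\<in>int_group_ring (grp_of P). Pi2_scale P k a \<in> M)"

definition generates_Pi2 :: "('x, 'r) grp_presentation \<Rightarrow> ('x, 'r) C_elt set \<Rightarrow> bool" where
  "generates_Pi2 P S \<longleftrightarrow>
     S \<subseteq> carrier (Pi2 P) \<and> \<Inter>{M. Pi2_submodule P M \<and> S \<subseteq> M} = carrier (Pi2 P)"


section \<open>Logged rewrite systems\<close>

type_synonym ('x, 'r) logged_rule =
  "('x \<times> bool) list \<times> ('x, 'r) Y_letter list \<times> ('x \<times> bool) list"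

definition rules_of ::
    "('x, 'r) logged_rule set \<Rightarrow> (('x \<times> bool) list \<times> ('x \<times> bool) list) set" where
  "rules_of L = (\<lambda>(l, c, r). (l, r)) ` L"

definition rewriting_system_for ::
    "('x, 'r) grp_presentation \<Rightarrow> (('x \<times> bool) list \<times> ('x \<times> bool) list) set \<Rightarrow> bool" where
  "rewriting_system_for P S \<longleftrightarrow>
     S \<subseteq> lists (bar (gens P)) \<times> lists (bar (gens P)) \<and>
     (\<exists>h \<in> iso (presented_monoid (bar (gens P)) S) (grp_of P).
        \<forall>w\<in>lists (bar (gens P)). h (word_class (bar (gens P)) S w) = quot_map P (X_class P w))"

definition logged_rewrite_system ::
    "('x, 'r) grp_presentation \<Rightarrow> ('x, 'r) logged_rule set \<Rightarrow> bool" where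
  "logged_rewrite_system P L \<longleftrightarrow>
     finite L \<and> rewriting_system_for P (rules_of L) \<and>
     (\<forall>(l, c, r)\<in>L. c \<in> lists (Ybar P) \<and>
        X_class P l = delta P c \<otimes>\<^bsub>FX P\<^esub> X_class P r)"

definition complete_logged_rewrite_system ::
    "('x, 'r) grp_presentation \<Rightarrow> ('x, 'r) logged_rule set \<Rightarrow> bool" where
  "complete_logged_rewrite_system P L \<longleftrightarrow>
     logged_rewrite_system P L \<and> complete_rewriting (bar (gens P)) (rules_of L)"

definition logged_step ::
    "('x, 'r) grp_presentation \<Rightarrow> ('x, 'r) logged_rule set \<Rightarrow>
     ('x \<times> bool) list \<times> ('x, 'r) Y_letter list \<Rightarrow>
     ('x \<times> bool) list \<times> ('x, 'r) Y_letter list \<Rightarrow> bool" where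
  "logged_step P L s s' \<longleftrightarrow>
     (\<exists>u\<in>lists (bar (gens P)). \<exists>v\<in>lists (bar (gens P)). \<exists>(l, c, r)\<in>L.
        fst s = u @ l @ v \<and>
        s' = (u @ r @ v, snd s @ Yseq_act P c (inv\<^bsub>FX P\<^esub> (X_class P u))))"

definition is_log ::
    "('x, 'r) grp_presentation \<Rightarrow> ('x, 'r) logged_rule set \<Rightarrow>
     ('x \<times> bool) list \<Rightarrow> ('x, 'r) Y_letter list \<Rightarrow> bool" where
  "is_log P L w c \<longleftrightarrow>
     (\<exists>z. (logged_step P L)\<^sup>*\<^sup>* (w, []) (z, c) \<and>
          irreducible_word (bar (gens P)) (rules_of L) z)"

definition sect ::
    "('x, 'r) grp_presentation \<Rightarrow> ('x, 'r) logged_rule set \<Rightarrow> 'x free_elt set \<Rightarrow> 'x free_elt" where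
  "sect P L g = X_class P
     (THE w. w \<in> lists (bar (gens P)) \<and> irreducible_word (bar (gens P)) (rules_of L) w \<and>
             quot_map P (X_class P w) = g)"


section \<open>Groupoids and the Cayley graph\<close>

text \<open>Composition \<open>gcomp A a b\<close> is in path order: first \<open>a\<close>, then \<open>b\<close>.\<close>

record ('o, 'a) groupoid =
  gobj :: "'o set"
  garr :: "'a set"
  gsrc :: "'a \<Rightarrow> 'o"
  gtgt :: "'a \<Rightarrow> 'o"
  gid :: "'o \<Rightarrow> 'a"
  gcomp :: "'a \<Rightarrow> 'a \<Rightarrow> 'a"

definition groupoid_morphism ::
    "('o, 'a) groupoid \<Rightarrow> ('p, 'b) groupoid \<Rightarrow> ('o \<Rightarrow> 'p) \<Rightarrow> ('a \<Rightarrow> 'b) \<Rightarrow> bool" where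
  "groupoid_morphism A B f0 f1 \<longleftrightarrow>
     f0 \<in> gobj A \<rightarrow> gobj B \<and> f1 \<in> garr A \<rightarrow> garr B \<and>
     (\<forall>a\<in>garr A. gsrc B (f1 a) = f0 (gsrc A a) \<and> gtgt B (f1 a) = f0 (gtgt A a)) \<and>
     (\<forall>v\<in>gobj A. f1 (gid A v) = gid B (f0 v)) \<and>
     (\<forall>a\<in>garr A. \<forall>b\<in>garr A. gtgt A a = gsrc A b \<longrightarrow>
        f1 (gcomp A a b) = gcomp B (f1 a) (f1 b))"

definition one_object_groupoid :: "('a, 'm) monoid_scheme \<Rightarrow> (unit, 'a) groupoid" where
  "one_object_groupoid H =
     \<lparr>gobj = {()}, garr = carrier H, gsrc = (\<lambda>_. ()), gtgt = (\<lambda>_. ()),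
      gid = (\<lambda>_. \<one>\<^bsub>H\<^esub>), gcomp = monoid.mult H\<rparr>"

definition bar_graph :: "('v, 'e) pre_digraph \<Rightarrow> ('v, 'e \<times> bool) pre_digraph" where
  "bar_graph \<Gamma> =
     \<lparr>verts = verts \<Gamma>, arcs = bar (arcs \<Gamma>),
      tail = (\<lambda>(e, s). if s then tail \<Gamma> e else head \<Gamma> e),
      head = (\<lambda>(e, s). if s then head \<Gamma> e else tail \<Gamma> e)\<rparr>"

definition walk_class ::
    "('v, 'e) pre_digraph \<Rightarrow> 'v \<Rightarrow> ('e \<times> bool) list \<Rightarrow> 'v \<Rightarrow> ('e \<times> bool) list set" where
  "walk_class \<Gamma> u p v =
     {q. equivclp (\<lambda>p q. pre_digraph.awalk (bar_graph \<Gamma>) u p v \<and>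
                         pre_digraph.awalk (bar_graph \<Gamma>) u q v \<and>
                         rstep (bar (arcs \<Gamma>)) (cancel_rules (arcs \<Gamma>)) p q) p q}"

text \<open>An arrow of the free groupoid is a walk traversing edges in either direction, modulo
  cancellation, together with its end points.\<close>

definition free_groupoid ::
    "('v, 'e) pre_digraph \<Rightarrow> ('v, 'v \<times> ('e \<times> bool) list set \<times> 'v) groupoid" where
  "free_groupoid \<Gamma> =
     \<lparr>gobj = verts \<Gamma>,
      garr = {(u, walk_class \<Gamma> u p v, v) | u p v. pre_digraph.awalk (bar_graph \<Gamma>) u p v},
      gsrc = fst,
      gtgt = snd \<circ> snd,
      gid = (\<lambda>u. (u, walk_class \<Gamma> u [] u, u)),
      gcomp = (\<lambda>(u, p, v) (v', q, w).
        (u, \<Union>a\<in>p. \<Union>b\<in>q. walk_class \<Gamma> u (a @ b) w, w))\<rparr>"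

type_synonym 'x cayley_arrow =
  "'x free_elt set \<times> (('x free_elt set \<times> 'x) \<times> bool) list set \<times> 'x free_elt set"

definition cayley_graph ::
    "('x, 'r) grp_presentation \<Rightarrow> ('x free_elt set, 'x free_elt set \<times> 'x) pre_digraph" where
  "cayley_graph P =
     \<lparr>verts = carrier (grp_of P), arcs = carrier (grp_of P) \<times> gens P,
      tail = fst, head = (\<lambda>(g, x). g \<otimes>\<^bsub>grp_of P\<^esub> quot_map P (gen P x))\<rparr>"

fun lift_walk ::
    "('x, 'r) grp_presentation \<Rightarrow> 'x free_elt set \<Rightarrow> ('x \<times> bool) list \<Rightarrow>
     (('x free_elt set \<times> 'x) \<times> bool) list" where
  "lift_walk P g [] = []"
| "lift_walk P g ((x, True) # w) =
     ((g, x), True) # lift_walk P (g \<otimes>\<^bsub>grp_of P\<^esub> quot_map P (gen P x)) w"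
| "lift_walk P g ((x, False) # w) =
     (let h = g \<otimes>\<^bsub>grp_of P\<^esub> inv\<^bsub>grp_of P\<^esub> (quot_map P (gen P x))
      in ((h, x), False) # lift_walk P h w)"

text \<open>\<open>cayley_path P g u\<close> is the arrow \<open>[g, u]\<close>.\<close>

definition cayley_path ::
    "('x, 'r) grp_presentation \<Rightarrow> 'x free_elt set \<Rightarrow> 'x free_elt \<Rightarrow> 'x cayley_arrow" where
  "cayley_path P g u =
     (let h = g \<otimes>\<^bsub>grp_of P\<^esub> quot_map P u
      in (g, \<Union>w\<in>u. walk_class (cayley_graph P) g (lift_walk P g w) h, h))"


section \<open>The morphism determined by the logs\<close>

definition edge_elt ::
    "('x, 'r) grp_presentation \<Rightarrow> ('x, 'r) logged_rule set \<Rightarrow> 'x free_elt set \<Rightarrow> 'x \<Rightarrow> 'x free_elt" where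
  "edge_elt P L g x =
     sect P L g \<otimes>\<^bsub>FX P\<^esub> gen P x \<otimes>\<^bsub>FX P\<^esub>
     inv\<^bsub>FX P\<^esub> (sect P L (g \<otimes>\<^bsub>grp_of P\<^esub> quot_map P (gen P x)))"

text \<open>A logged reduction starts from a word, whereas \<open>edge_elt\<close> is an element of \<open>F(X)\<close>; the
  parameter \<open>w\<close> is an arbitrary choice of words representing these elements.\<close>

definition edge_words ::
    "('x, 'r) grp_presentation \<Rightarrow> ('x, 'r) logged_rule set \<Rightarrow>
     ('x free_elt set \<Rightarrow> 'x \<Rightarrow> ('x \<times> bool) list) \<Rightarrow> bool" where
  "edge_words P L w \<longleftrightarrow>
     (\<forall>g\<in>carrier (grp_of P). \<forall>x\<in>gens P.
        w g x \<in> lists (bar (gens P)) \<and> X_class P (w g x) = edge_elt P L g x)"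

definition edge_logs ::
    "('x, 'r) grp_presentation \<Rightarrow> ('x, 'r) logged_rule set \<Rightarrow>
     ('x free_elt set \<Rightarrow> 'x \<Rightarrow> ('x \<times> bool) list) \<Rightarrow>
     ('x free_elt set \<Rightarrow> 'x \<Rightarrow> ('x, 'r) C_elt) \<Rightarrow> bool" where
  "edge_logs P L w \<kappa> \<longleftrightarrow>
     (\<forall>g\<in>carrier (grp_of P). \<forall>x\<in>gens P.
        (\<exists>c. is_log P L (w g x) c \<and> \<kappa> g x = C_class P c) \<and>
        ((\<exists>c. is_log P L (w g x) c \<and> C_class P c = C_class P []) \<longrightarrow> \<kappa> g x = C_class P []))"

definition extends_edge_map ::
    "('x, 'r) grp_presentation \<Rightarrow> ('x free_elt set \<Rightarrow> 'x \<Rightarrow> ('x, 'r) C_elt) \<Rightarrow>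
     ('x cayley_arrow \<Rightarrow> ('x, 'r) C_elt) \<Rightarrow> bool" where
  "extends_edge_map P \<kappa> k1 \<longleftrightarrow>
     groupoid_morphism (free_groupoid (cayley_graph P)) (one_object_groupoid (CR P)) (\<lambda>_. ()) k1 \<and>
     (\<forall>g\<in>carrier (grp_of P). \<forall>x\<in>gens P. k1 (cayley_path P g (gen P x)) = \<kappa> g x)"

definition identity_gen ::
    "('x, 'r) grp_presentation \<Rightarrow> ('x, 'r) logged_rule set \<Rightarrow>
     ('x cayley_arrow \<Rightarrow> ('x, 'r) C_elt) \<Rightarrow> 'x free_elt set \<Rightarrow> 'r \<Rightarrow> ('x, 'r) C_elt" where
  "identity_gen P L k1 g \<rho> =
     C_class P [((\<rho>, inv\<^bsub>FX P\<^esub> (sect P L g)), False)] \<otimes>\<^bsub>CR P\<^esub>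
     k1 (cayley_path P g (relator P \<rho>))"

end

theory Submission
  imports Defs
begin

text \<open>Write \<open>K g u = k\<^sub>1 [g, u]\<close>, so that \<open>K g (u v) = K g u \<cdot> K (g (\<phi> u)) v\<close> and
  \<open>\<delta>\<^sub>2 (K g u) = (\<sigma> g) u (\<sigma> (g (\<phi> u)))\<^sup>-\<^sup>1\<close>. The empty word is irreducible, so \<open>\<sigma> 1 = 1\<close>, and hence
  \<open>K 1\<close> restricts to a section of \<open>\<delta>\<^sub>2\<close> on the normal closure \<open>N\<close> of the relators. As \<open>\<Pi>\<^sub>2\<close> is
  central in \<open>C(R)\<close>, the map \<open>p c = c\<^sup>-\<^sup>1 \<cdot> K 1 (\<delta>\<^sub>2 c)\<close> is a morphism onto \<open>\<Pi>\<^sub>2\<close>, given by inversion on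
  \<open>\<Pi>\<^sub>2\<close>; so \<open>\<Pi>\<^sub>2\<close> is generated, even as a group, by the images under \<open>p\<close> of the generators
  \<open>(\<rho>\<^sup>+)\<^sup>u\<close> of \<open>C(R)\<close>. With \<open>g = \<phi> (u\<^sup>-\<^sup>1)\<close>, the factorisation
  \<open>K 1 (u\<^sup>-\<^sup>1 (\<omega> \<rho>) u) = K 1 (u\<^sup>-\<^sup>1) \<cdot> K g (\<omega> \<rho>) \<cdot> (K 1 (u\<^sup>-\<^sup>1))\<^sup>-\<^sup>1\<close> and the Peiffer identity show that this
  image is a conjugate of \<open>\<iota>\<^bsub>[g, \<rho>]\<^esub>\<close>, hence equal to it.\<close>

section \<open>Presented monoids\<close>

text \<open>Membership in \<open>lists A\<close> is treated as a whole, through its rules for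
  \<open>[]\<close>, \<open>#\<close> and \<open>@\<close>, and not split into membership of the
  single letters.\<close>

declare in_listsD [rule del] in_listsI [rule del]

text \<open>The source of well-definedness below: a function on words or walks that no single step
  changes descends to classes. With a predicate as \<open>f\<close>, it also carries the property of
  being a word over \<open>A\<close>, or a walk with given ends, to equivalent words.\<close>

lemma equivclp_invariant:
  assumes "equivclp r x y" and "\<And>x y. r x y \<Longrightarrow> f x = f y"
  shows "f x = f y"
  using assms(1) by induction (auto dest: assms(2))

locale string_rewriting =
  fixes A :: "'a set" and S :: "('a list \<times> 'a list) set"
  assumes rules_in: "S \<subseteq> lists A \<times> lists A"
begin

abbreviation equ :: "'a list \<Rightarrow> 'a list \<Rightarrow> bool" (infix "\<leftrightarrow>" 50) where
  "equ \<equiv> equivclp (rstep A S)"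

abbreviation cl :: "'a list \<Rightarrow> 'a list set" where "cl \<equiv> word_class A S"

abbreviation M :: "'a list set monoid" where "M \<equiv> presented_monoid A S"

lemma rstep_in_lists: "rstep A S z z' \<Longrightarrow> z \<in> lists A \<and> z' \<in> lists A"
  using rules_in unfolding rstep_def by auto

lemma equ_in_lists: "z \<leftrightarrow> z' \<Longrightarrow> z \<in> lists A \<Longrightarrow> z' \<in> lists A"
  using equivclp_invariant[of "rstep A S" z z' "\<lambda>z. z \<in> lists A"] rstep_in_lists by blast

lemma rule_rstep: "(l, r) \<in> S \<Longrightarrow> rstep A S l r"
  unfolding rstep_def by (intro bexI[of _ "[]"] bexI[of _ "(l, r)"]) auto

lemma rstep_context:
  assumes "rstep A S z z'" "a \<in> lists A" "b \<in> lists A"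
  shows "rstep A S (a @ z @ b) (a @ z' @ b)"
proof -
  from assms(1) obtain u v l r where uv: "u \<in> lists A" "v \<in> lists A" "(l, r) \<in> S"
      "z = u @ l @ v" "z' = u @ r @ v"
    unfolding rstep_def by auto
  then have "a @ z @ b = (a @ u) @ l @ (v @ b)" "a @ z' @ b = (a @ u) @ r @ (v @ b)"
    "a @ u \<in> lists A" "v @ b \<in> lists A"
    using assms(2,3) by auto
  with uv(3) show ?thesis unfolding rstep_def by blast
qed

lemma equ_trans [trans]: "x \<leftrightarrow> y \<Longrightarrow> y \<leftrightarrow> z \<Longrightarrow> x \<leftrightarrow> z"
  by (rule transpD[OF transp_equivclp])

lemma equ_context:
  assumes "z \<leftrightarrow> z'" "a \<in> lists A" "b \<in> lists A"
  shows "a @ z @ b \<leftrightarrow> a @ z' @ b"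
  using assms(1)
proof induction
  case (step y z)
  then show ?case
    using rstep_context[OF _ assms(2,3)] equ_trans by blast
qed simp

lemma equ_append:
  assumes "a \<leftrightarrow> a'" "b \<leftrightarrow> b'" "a \<in> lists A" "b \<in> lists A"
  shows "a @ b \<leftrightarrow> a' @ b'"
proof -
  have "a @ b \<leftrightarrow> a' @ b" using equ_context[OF assms(1), of "[]" b] assms by simp
  also have "a' @ b \<leftrightarrow> a' @ b'"
    using equ_context[OF assms(2), of "a'" "[]"] equ_in_lists[OF assms(1,3)] by simp
  finally show ?thesis .
qed

lemma mem_cl: "w' \<in> cl w \<longleftrightarrow> w \<leftrightarrow> w'"
  by (simp add: word_class_def)

lemma self_in_cl: "w \<in> cl w"
  by (simp add: mem_cl)

lemma cl_eq_iff: "cl w = cl w' \<longleftrightarrow> w \<leftrightarrow> w'"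
proof
  show "w \<leftrightarrow> w'" if "cl w = cl w'" using self_in_cl[of w'] that mem_cl by blast
  show "cl w = cl w'" if "w \<leftrightarrow> w'"
    using that equ_trans equivclp_sym[OF that] unfolding word_class_def by blast
qed

lemma cl_rule: "(l, r) \<in> S \<Longrightarrow> cl l = cl r"
  using rule_rstep by (simp add: cl_eq_iff r_into_equivclp)

lemma cl_in_carrier: "w \<in> lists A \<Longrightarrow> cl w \<in> carrier M"
  by (simp add: presented_monoid_def)

lemma carrierE:
  assumes "k \<in> carrier M"
  obtains w where "w \<in> lists A" "k = cl w"
  using assms by (auto simp: presented_monoid_def)

lemma one_eq: "\<one>\<^bsub>M\<^esub> = cl []"
  by (simp add: presented_monoid_def)

text \<open>The product is defined as a union over all pairs of representatives. By
  \<open>equ_append\<close> the classes united are all the same, so the union is a single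
  class.\<close>

lemma mult_cl:
  assumes "u \<in> lists A" "v \<in> lists A"
  shows "cl u \<otimes>\<^bsub>M\<^esub> cl v = cl (u @ v)"
proof -
  have "cl (u' @ v') = cl (u @ v)" if "u' \<in> cl u" "v' \<in> cl v" for u' v'
    using that equ_append[of u u' v v'] assms by (metis cl_eq_iff mem_cl)
  then have "(\<Union>u'\<in>cl u. \<Union>v'\<in>cl v. cl (u' @ v')) = (\<Union>u'\<in>cl u. \<Union>v'\<in>cl v. cl (u @ v))"
    by simp
  also have "\<dots> = cl (u @ v)" using self_in_cl[of u] self_in_cl[of v] by auto
  finally have "(\<Union>u'\<in>cl u. \<Union>v'\<in>cl v. cl (u' @ v')) = cl (u @ v)" .
  then show ?thesis by (simp add: presented_monoid_def)
qed

lemma monoid_M: "monoid M"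
proof (rule monoidI)
  fix x y z assume "x \<in> carrier M" "y \<in> carrier M" "z \<in> carrier M"
  then show "x \<otimes>\<^bsub>M\<^esub> y \<otimes>\<^bsub>M\<^esub> z = x \<otimes>\<^bsub>M\<^esub> (y \<otimes>\<^bsub>M\<^esub> z)"
    by (elim carrierE) (simp add: mult_cl)
next
  fix x y assume "x \<in> carrier M" "y \<in> carrier M"
  then show "x \<otimes>\<^bsub>M\<^esub> y \<in> carrier M"
    by (elim carrierE) (simp add: mult_cl cl_in_carrier)
next
  fix x assume "x \<in> carrier M"
  then show "\<one>\<^bsub>M\<^esub> \<otimes>\<^bsub>M\<^esub> x = x" "x \<otimes>\<^bsub>M\<^esub> \<one>\<^bsub>M\<^esub> = x"
    by (elim carrierE, simp add: mult_cl one_eq)+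
qed (simp add: one_eq cl_in_carrier)

text \<open>Left inverses of the letters suffice: they are collected in reverse order, and the
  product collapses from the middle outwards.\<close>

lemma group_M:
  assumes "\<And>y. y \<in> A \<Longrightarrow> \<exists>y'\<in>A. [y', y] \<leftrightarrow> []"
  shows "group M"
proof (rule monoid.group_l_invI[OF monoid_M])
  fix k assume "k \<in> carrier M"
  then obtain w where w: "w \<in> lists A" "k = cl w" by (rule carrierE)
  have "\<exists>w'\<in>lists A. w' @ w \<leftrightarrow> []" using w(1)
  proof (induction w)
    case Nil
    then show ?case by (metis append_Nil equivclp_refl lists.Nil)
  next
    case (Cons y w)
    then obtain w' where w': "w' \<in> lists A" "w' @ w \<leftrightarrow> []" by auto
    obtain y' where y': "y' \<in> A" "[y', y] \<leftrightarrow> []" using assms Cons by blast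
    have "w' @ [y', y] @ w \<leftrightarrow> w' @ [] @ w"
      using y'(2) w'(1) Cons(2) by (intro equ_context) auto
    then have "(w' @ [y']) @ (y # w) \<leftrightarrow> []" using w'(2) equ_trans by simp
    then show ?case using w' y' by (intro bexI[of _ "w' @ [y']"]) auto
  qed
  then obtain w' where w': "w' \<in> lists A" "w' @ w \<leftrightarrow> []" by blast
  then have "cl w' \<otimes>\<^bsub>M\<^esub> k = \<one>\<^bsub>M\<^esub>"
    using w by (simp add: mult_cl one_eq cl_eq_iff)
  then show "\<exists>y\<in>carrier M. y \<otimes>\<^bsub>M\<^esub> k = \<one>\<^bsub>M\<^esub>"
    using w' cl_in_carrier by blast
qed

end

section \<open>Evaluation of words in a monoid\<close>

definition word_val :: "('a, 'm) monoid_scheme \<Rightarrow> ('b \<Rightarrow> 'a) \<Rightarrow> 'b list \<Rightarrow> 'a" where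
  "word_val G f c = foldr (\<lambda>y a. f y \<otimes>\<^bsub>G\<^esub> a) c \<one>\<^bsub>G\<^esub>"

lemma word_val_simps [simp]:
  "word_val G f [] = \<one>\<^bsub>G\<^esub>" "word_val G f (y # c) = f y \<otimes>\<^bsub>G\<^esub> word_val G f c"
  by (simp_all add: word_val_def)

context monoid
begin

lemma word_val_closed:
  assumes "f \<in> B \<rightarrow> carrier G" "c \<in> lists B"
  shows "word_val G f c \<in> carrier G"
  using assms(2) by induction (simp_all add: Pi_mem[OF assms(1)])

lemma word_val_append:
  assumes "f \<in> B \<rightarrow> carrier G" "c \<in> lists B" "d \<in> lists B"
  shows "word_val G f (c @ d) = word_val G f c \<otimes> word_val G f d"
  using assms(2)
  by induction
    (simp_all add: m_assoc Pi_mem[OF assms(1)] word_val_closed[OF assms(1)] assms(3))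

text \<open>The universal property of a presented monoid, in the form needed for both \<delta> (with
  values in the free group) and the value of a path (with values in C(R)).\<close>

lemma word_val_equiv:
  assumes rules: "S \<subseteq> lists B \<times> lists B" and f: "f \<in> B \<rightarrow> carrier G"
    and inv: "\<And>l r. (l, r) \<in> S \<Longrightarrow> word_val G f l = word_val G f r"
    and "equivclp (rstep B S) c d"
  shows "word_val G f c = word_val G f d"
proof (rule equivclp_invariant[OF assms(4)])
  fix x y assume "rstep B S x y"
  then obtain u v l r where uv: "u \<in> lists B" "v \<in> lists B" "(l, r) \<in> S"
      "x = u @ l @ v" "y = u @ r @ v"
    unfolding rstep_def by auto
  moreover have "l \<in> lists B" "r \<in> lists B" using rules uv(3) by auto
  ultimately show "word_val G f x = word_val G f y"
    using inv uv(3) by (simp add: word_val_append[OF f])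
qed

end

section \<open>The doubled alphabet and free groups\<close>

lemma letter_inv_simps [simp]: "letter_inv (a, s) = (a, \<not> s)" "letter_inv (letter_inv y) = y"
  by (simp_all add: letter_inv_def)

lemma letter_inv_in_bar [simp]: "letter_inv y \<in> bar A \<longleftrightarrow> y \<in> bar A"
  by (cases y) (simp add: bar_def letter_inv_def)

lemma mem_bar [simp]: "(a, s) \<in> bar A \<longleftrightarrow> a \<in> A"
  by (simp add: bar_def)

lemma cancel_rulesE:
  assumes "(l, r) \<in> cancel_rules A"
  obtains y where "y \<in> bar A" "l = [y, letter_inv y]" "r = []"
proof -
  from assms obtain y where y: "(l, r) = ([y, letter_inv y], [])" "y \<in> bar A"
    unfolding cancel_rules_def by (rule imageE)
  then show thesis using that by (simp only: prod.inject)
qed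

lemma cancel_rules_in: "cancel_rules A \<subseteq> lists (bar A) \<times> lists (bar A)"
  by (auto simp: cancel_rules_def)

lemma free_string_rewriting: "string_rewriting (bar A) (cancel_rules A)"
  by unfold_locales (rule cancel_rules_in)

text \<open>Inversion of letters is an involution, so the cancellation rule at
  \<open>letter_inv y\<close> has \<open>y\<close> as its second letter and provides the left
  inverse.\<close>

lemma group_free_group: "group (free_group A)"
proof (rule string_rewriting.group_M[OF free_string_rewriting])
  fix y assume y: "y \<in> bar A"
  have "([letter_inv y, y], []) \<in> cancel_rules A"
    unfolding cancel_rules_def using y by (intro image_eqI[of _ _ "letter_inv y"]) auto
  then have "equivclp (rstep (bar A) (cancel_rules A)) [letter_inv y, y] []"
    by (intro r_into_equivclp string_rewriting.rule_rstep[OF free_string_rewriting])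
  then show "\<exists>y'\<in>bar A. equivclp (rstep (bar A) (cancel_rules A)) [y', y] []"
    using y by (intro bexI[of _ "letter_inv y"]) auto
qed

section \<open>The crossed module of a presentation\<close>

locale presentation =
  fixes P :: "('x, 'r) grp_presentation"
  assumes is_presentation: "is_presentation P"
begin

sublocale X: string_rewriting "bar (gens P)" "cancel_rules (gens P)"
  by (rule free_string_rewriting)

sublocale F: group "FX P"
  by (rule group_free_group)

lemma relator_closed: "\<rho> \<in> labels P \<Longrightarrow> relator P \<rho> \<in> carrier (FX P)"
  using is_presentation by (auto simp: is_presentation_def)

lemma Y_act_closed: "y \<in> Ybar P \<Longrightarrow> v \<in> carrier (FX P) \<Longrightarrow> Y_act P y v \<in> Ybar P"
  by (cases "(P, y, v)" rule: Y_act.cases) auto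

lemma delta_letter_closed: "y \<in> Ybar P \<Longrightarrow> delta_letter P y \<in> carrier (FX P)"
  by (cases "(P, y)" rule: delta_letter.cases) (auto simp: relator_closed)

lemma delta_letter_Pi: "delta_letter P \<in> Ybar P \<rightarrow> carrier (FX P)"
  using delta_letter_closed by blast

lemma delta_letter_inv:
  "y \<in> Ybar P \<Longrightarrow> delta_letter P (letter_inv y) = inv\<^bsub>FX P\<^esub> delta_letter P y"
  by (cases "(P, y)" rule: delta_letter.cases)
    (auto simp: relator_closed F.inv_mult_group F.m_assoc)

lemma delta_letter_act:
  "y \<in> Ybar P \<Longrightarrow> v \<in> carrier (FX P) \<Longrightarrow>
    delta_letter P (Y_act P y v) = inv\<^bsub>FX P\<^esub> v \<otimes>\<^bsub>FX P\<^esub> delta_letter P y \<otimes>\<^bsub>FX P\<^esub> v"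
  by (cases "(P, y)" rule: delta_letter.cases)
    (auto simp: relator_closed F.inv_mult_group F.m_assoc)

lemma Y_act_inv: "Y_act P (letter_inv y) v = letter_inv (Y_act P y v)"
  by (cases "(P, y, v)" rule: Y_act.cases) auto

lemma Y_act_mult:
  "y \<in> Ybar P \<Longrightarrow> u \<in> carrier (FX P) \<Longrightarrow> v \<in> carrier (FX P) \<Longrightarrow>
    Y_act P (Y_act P y u) v = Y_act P y (u \<otimes>\<^bsub>FX P\<^esub> v)"
  by (cases "(P, y, v)" rule: Y_act.cases) (auto simp: F.m_assoc)

lemma Y_act_one: "y \<in> Ybar P \<Longrightarrow> Y_act P y \<one>\<^bsub>FX P\<^esub> = y"
  by (cases "(P, y, \<one>\<^bsub>FX P\<^esub>)" rule: Y_act.cases) auto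

lemma peiffer_ruleI:
  "y \<in> Ybar P \<Longrightarrow> z \<in> Ybar P \<Longrightarrow>
    ([letter_inv y, z, y], [Y_act P z (delta_letter P y)]) \<in> peiffer_rules P"
  "y \<in> Ybar P \<Longrightarrow> ([y, letter_inv y], []) \<in> peiffer_rules P"
  unfolding peiffer_rules_def by blast+

lemma peiffer_rule_cases [consumes 1, case_names conj cancel]:
  assumes "(l, r) \<in> peiffer_rules P"
  obtains y z where "y \<in> Ybar P" "z \<in> Ybar P" "l = [letter_inv y, z, y]"
      "r = [Y_act P z (delta_letter P y)]"
    | y where "y \<in> Ybar P" "l = [y, letter_inv y]" "r = []"
  using assms unfolding peiffer_rules_def by blast

lemma peiffer_rules_in: "peiffer_rules P \<subseteq> lists (Ybar P) \<times> lists (Ybar P)"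
  by (auto simp del: Y_act.simps delta_letter.simps
      simp: peiffer_rules_def Y_act_closed delta_letter_closed)

sublocale Y: string_rewriting "Ybar P" "peiffer_rules P"
  by unfold_locales (rule peiffer_rules_in)

sublocale C: group "CR P"
  unfolding CR_def
proof (rule Y.group_M)
  fix y assume y: "y \<in> Ybar P"
  have "([letter_inv y, letter_inv (letter_inv y)], []) \<in> peiffer_rules P"
    using y by (intro peiffer_ruleI) simp
  then have "Y.equ [letter_inv y, y] []"
    using r_into_equivclp[of "rstep (Ybar P) (peiffer_rules P)", OF Y.rule_rstep] by simp
  then show "\<exists>y'\<in>Ybar P. Y.equ [y', y] []"
    using y by (intro bexI[of _ "letter_inv y"]) auto
qed

lemma C_class_closed: "c \<in> lists (Ybar P) \<Longrightarrow> C_class P c \<in> carrier (CR P)"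
  by (simp add: CR_def Y.cl_in_carrier)

lemma C_mult:
  "c \<in> lists (Ybar P) \<Longrightarrow> d \<in> lists (Ybar P) \<Longrightarrow>
    C_class P c \<otimes>\<^bsub>CR P\<^esub> C_class P d = C_class P (c @ d)"
  by (simp add: CR_def Y.mult_cl)

lemma C_one: "\<one>\<^bsub>CR P\<^esub> = C_class P []"
  by (simp add: CR_def Y.one_eq)

lemma C_carrierE:
  assumes "k \<in> carrier (CR P)"
  obtains c where "c \<in> lists (Ybar P)" "k = C_class P c"
  using assms unfolding CR_def by (rule Y.carrierE)

lemma delta_eq_word_val: "delta P c = word_val (FX P) (delta_letter P) c"
  by (simp add: delta_def word_val_def)

lemma delta_closed: "c \<in> lists (Ybar P) \<Longrightarrow> delta P c \<in> carrier (FX P)"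
  using F.word_val_closed[OF delta_letter_Pi] by (simp add: delta_eq_word_val)

lemma delta_Nil: "delta P [] = \<one>\<^bsub>FX P\<^esub>"
  by (simp add: delta_eq_word_val)

lemma delta_Cons: "delta P (y # c) = delta_letter P y \<otimes>\<^bsub>FX P\<^esub> delta P c"
  by (simp add: delta_eq_word_val)

lemma delta_append:
  "c \<in> lists (Ybar P) \<Longrightarrow> d \<in> lists (Ybar P) \<Longrightarrow> delta P (c @ d) = delta P c \<otimes>\<^bsub>FX P\<^esub> delta P d"
  using F.word_val_append[OF delta_letter_Pi] by (simp add: delta_eq_word_val)

text \<open>Both sides of a conjugation rule have as boundary the conjugate of the boundary of
  \<open>z\<close> by that of \<open>y\<close>; for the right side this is
  \<open>delta_letter_act\<close>, the first crossed module axiom on letters.\<close>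

lemma delta_peiffer:
  assumes "(l, r) \<in> peiffer_rules P"
  shows "delta P l = delta P r"
  using assms
  by (cases rule: peiffer_rule_cases)
    (simp_all add: delta_Cons delta_Nil delta_letter_act delta_letter_inv
      delta_letter_closed F.m_assoc)

lemma delta_equ:
  assumes "Y.equ c d"
  shows "delta P c = delta P d"
  using F.word_val_equiv[OF peiffer_rules_in delta_letter_Pi _ assms] delta_peiffer
  unfolding delta_eq_word_val by blast

lemma delta2_class: "delta2 P (C_class P c) = delta P c"
proof -
  have "delta P ` C_class P c = {delta P c}"
    using delta_equ Y.self_in_cl by (fastforce simp: Y.mem_cl)
  then show ?thesis by (simp add: delta2_def)
qed

sublocale delta2: group_hom "CR P" "FX P" "delta2 P"
proof (unfold_locales, rule homI)
  fix k assume "k \<in> carrier (CR P)"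
  then show "delta2 P k \<in> carrier (FX P)"
    by (elim C_carrierE) (simp add: delta2_class delta_closed)
  fix l assume "l \<in> carrier (CR P)"
  with \<open>k \<in> carrier (CR P)\<close>
  show "delta2 P (k \<otimes>\<^bsub>CR P\<^esub> l) = delta2 P k \<otimes>\<^bsub>FX P\<^esub> delta2 P l"
    by (elim C_carrierE) (simp add: delta2_class C_mult delta_append)
qed

section \<open>The action of F(X) on Y-sequences and on C(R)\<close>

lemma Yseq_act_simps [simp]:
  "Yseq_act P [] v = []" "Yseq_act P (y # c) v = Y_act P y v # Yseq_act P c v"
  "Yseq_act P (c @ d) v = Yseq_act P c v @ Yseq_act P d v"
  by (simp_all add: Yseq_act_def)

lemma Yseq_act_closed:
  "c \<in> lists (Ybar P) \<Longrightarrow> v \<in> carrier (FX P) \<Longrightarrow> Yseq_act P c v \<in> lists (Ybar P)"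
  by (induction c) (auto simp: Y_act_closed)

lemma Yseq_act_mult:
  "c \<in> lists (Ybar P) \<Longrightarrow> u \<in> carrier (FX P) \<Longrightarrow> v \<in> carrier (FX P) \<Longrightarrow>
    Yseq_act P (Yseq_act P c u) v = Yseq_act P c (u \<otimes>\<^bsub>FX P\<^esub> v)"
  by (induction c) (auto simp: Y_act_mult)

lemma Yseq_act_one: "c \<in> lists (Ybar P) \<Longrightarrow> Yseq_act P c \<one>\<^bsub>FX P\<^esub> = c"
  by (induction c) (auto simp: Y_act_one)

lemma delta_act:
  assumes v: "v \<in> carrier (FX P)" and "c \<in> lists (Ybar P)"
  shows "delta P (Yseq_act P c v) = inv\<^bsub>FX P\<^esub> v \<otimes>\<^bsub>FX P\<^esub> delta P c \<otimes>\<^bsub>FX P\<^esub> v"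
  using assms(2)
proof (induction c)
  case Nil
  then show ?case using v by (simp add: delta_Nil)
next
  case (Cons y c)
  then have "delta_letter P y \<in> carrier (FX P)" "delta P c \<in> carrier (FX P)"
    by (auto simp: delta_letter_closed delta_closed)
  moreover have "v \<otimes>\<^bsub>FX P\<^esub> (inv\<^bsub>FX P\<^esub> v \<otimes>\<^bsub>FX P\<^esub> z) = z" if "z \<in> carrier (FX P)" for z
    using that v by (simp flip: F.m_assoc)
  ultimately show ?case
    using Cons v by (simp add: delta_Cons delta_letter_act F.m_assoc)
qed

text \<open>Acting by \<open>v\<close> turns a rule for \<open>y\<close> and \<open>z\<close> into
  the rule for the acted letters. In the conjugation case the exponents agree because the boundary
  of \<open>y\<close> times \<open>v\<close> equals \<open>v\<close> times the boundary of the acted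
  \<open>y\<close>.\<close>

lemma peiffer_act:
  assumes "(l, r) \<in> peiffer_rules P" "v \<in> carrier (FX P)"
  shows "(Yseq_act P l v, Yseq_act P r v) \<in> peiffer_rules P"
  using assms(1)
proof (cases rule: peiffer_rule_cases)
  case yz: (conj y z)
  have d: "delta_letter P y \<in> carrier (FX P)" using yz by (simp add: delta_letter_closed)
  have "v \<otimes>\<^bsub>FX P\<^esub> delta_letter P (Y_act P y v) = delta_letter P y \<otimes>\<^bsub>FX P\<^esub> v"
    using assms(2) d yz(1) by (simp add: delta_letter_act F.m_assoc flip: F.m_assoc[of v])
  then have "Y_act P (Y_act P z (delta_letter P y)) v =
      Y_act P (Y_act P z v) (delta_letter P (Y_act P y v))"
    using yz assms(2) d by (simp add: Y_act_mult delta_letter_closed Y_act_closed)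
  then have "Yseq_act P l v = [letter_inv (Y_act P y v), Y_act P z v, Y_act P y v]"
    "Yseq_act P r v = [Y_act P (Y_act P z v) (delta_letter P (Y_act P y v))]"
    using yz by (simp_all add: Y_act_inv)
  then show ?thesis
    using peiffer_ruleI(1)[of "Y_act P y v" "Y_act P z v"] yz assms(2) by (simp add: Y_act_closed)
next
  case y: (cancel y)
  then have "Yseq_act P l v = [Y_act P y v, letter_inv (Y_act P y v)]" "Yseq_act P r v = []"
    by (simp_all add: Y_act_inv)
  then show ?thesis
    using peiffer_ruleI(2)[of "Y_act P y v"] y assms(2) by (simp add: Y_act_closed)
qed

lemma equ_act:
  assumes "Y.equ c d" "v \<in> carrier (FX P)"
  shows "Y.equ (Yseq_act P c v) (Yseq_act P d v)"
proof -
  have "rstep (Ybar P) (peiffer_rules P) (Yseq_act P c v) (Yseq_act P d v)"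
    if "rstep (Ybar P) (peiffer_rules P) c d" for c d
  proof -
    from that obtain a b l r where *: "a \<in> lists (Ybar P)" "b \<in> lists (Ybar P)"
        "(l, r) \<in> peiffer_rules P" "c = a @ l @ b" "d = a @ r @ b"
      unfolding rstep_def by auto
    show ?thesis
      using Y.rstep_context[OF Y.rule_rstep[OF peiffer_act[OF *(3) assms(2)]]
          Yseq_act_closed[OF *(1) assms(2)] Yseq_act_closed[OF *(2) assms(2)]]
      by (simp add: *)
  qed
  then have "C_class P (Yseq_act P c v) = C_class P (Yseq_act P d v)"
    by (intro equivclp_invariant[OF assms(1), of "\<lambda>c. C_class P (Yseq_act P c v)"])
      (auto simp: Y.cl_eq_iff)
  then show ?thesis by (simp add: Y.cl_eq_iff)
qed

text \<open>As with products, the union over representatives defining \<open>C_act\<close> consists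
  of equal classes, by \<open>equ_act\<close>.\<close>

lemma C_act_class:
  assumes "v \<in> carrier (FX P)"
  shows "C_act P (C_class P c) v = C_class P (Yseq_act P c v)"
proof -
  have "C_class P (Yseq_act P d v) = C_class P (Yseq_act P c v)" if "d \<in> C_class P c" for d
    using equ_act[OF _ assms, of c d] that by (simp add: Y.cl_eq_iff Y.mem_cl equivclp_sym)
  then have "C_act P (C_class P c) v = (\<Union>d\<in>C_class P c. C_class P (Yseq_act P c v))"
    unfolding C_act_def by (rule SUP_cong[OF refl])
  also have "\<dots> = C_class P (Yseq_act P c v)" using Y.self_in_cl[of c] by auto
  finally show ?thesis .
qed

lemma C_act_closed:
  "k \<in> carrier (CR P) \<Longrightarrow> v \<in> carrier (FX P) \<Longrightarrow> C_act P k v \<in> carrier (CR P)"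
  by (elim C_carrierE) (simp add: C_act_class C_class_closed Yseq_act_closed)

lemma C_act_mult:
  "k \<in> carrier (CR P) \<Longrightarrow> u \<in> carrier (FX P) \<Longrightarrow> v \<in> carrier (FX P) \<Longrightarrow>
    C_act P (C_act P k u) v = C_act P k (u \<otimes>\<^bsub>FX P\<^esub> v)"
  by (elim C_carrierE) (simp add: C_act_class Yseq_act_mult)

lemma C_act_one: "k \<in> carrier (CR P) \<Longrightarrow> C_act P k \<one>\<^bsub>FX P\<^esub> = k"
  by (elim C_carrierE) (simp add: C_act_class Yseq_act_one)

lemma C_act_hom:
  "k \<in> carrier (CR P) \<Longrightarrow> k' \<in> carrier (CR P) \<Longrightarrow> v \<in> carrier (FX P) \<Longrightarrow>
    C_act P (k \<otimes>\<^bsub>CR P\<^esub> k') v = C_act P k v \<otimes>\<^bsub>CR P\<^esub> C_act P k' v"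
  by (elim C_carrierE) (simp add: C_act_class C_mult Yseq_act_closed)

lemma delta2_act:
  "k \<in> carrier (CR P) \<Longrightarrow> v \<in> carrier (FX P) \<Longrightarrow>
    delta2 P (C_act P k v) = inv\<^bsub>FX P\<^esub> v \<otimes>\<^bsub>FX P\<^esub> delta2 P k \<otimes>\<^bsub>FX P\<^esub> v"
  by (elim C_carrierE) (simp add: C_act_class delta2_class delta_act)

section \<open>The Peiffer identity\<close>

lemma peiffer_letters:
  assumes "y \<in> Ybar P" "z \<in> Ybar P"
  shows "C_class P [z] \<otimes>\<^bsub>CR P\<^esub> C_class P [y] =
    C_class P [y] \<otimes>\<^bsub>CR P\<^esub> C_act P (C_class P [z]) (delta_letter P y)"
proof -
  have d: "delta_letter P y \<in> carrier (FX P)" using assms delta_letter_closed by blast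
  have e: "C_class P [letter_inv y, z, y] = C_class P [Y_act P z (delta_letter P y)]"
    using assms by (intro Y.cl_rule peiffer_ruleI)
  \<comment> \<open>Replacing the acted letter by its conjugate word puts
    \<open>letter_inv y\<close> next to \<open>y\<close>, where the two cancel.\<close>
  have "C_class P [y] \<otimes>\<^bsub>CR P\<^esub> C_act P (C_class P [z]) (delta_letter P y) =
      C_class P [y] \<otimes>\<^bsub>CR P\<^esub> C_class P [letter_inv y, z, y]"
    using d by (simp add: C_act_class e)
  also have "\<dots> = C_class P [y, letter_inv y] \<otimes>\<^bsub>CR P\<^esub> C_class P [z, y]"
    using assms by (simp add: C_mult)
  also have "C_class P [y, letter_inv y] = \<one>\<^bsub>CR P\<^esub>"
    unfolding C_one using assms by (intro Y.cl_rule peiffer_ruleI)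
  finally show ?thesis using assms by (simp add: C_mult C_class_closed)
qed

text \<open>Induction on the left factor: \<open>y\<close> moves leftwards past one letter at a
  time, and the action is multiplicative.\<close>

lemma peiffer_letter:
  assumes "y \<in> Ybar P" "k \<in> carrier (CR P)"
  shows "k \<otimes>\<^bsub>CR P\<^esub> C_class P [y] = C_class P [y] \<otimes>\<^bsub>CR P\<^esub> C_act P k (delta_letter P y)"
proof -
  let ?y = "C_class P [y]" and ?d = "delta_letter P y"
  have d: "?d \<in> carrier (FX P)" using assms delta_letter_closed by blast
  have y: "?y \<in> carrier (CR P)" using assms C_class_closed by simp
  obtain c where c: "c \<in> lists (Ybar P)" "k = C_class P c" using assms C_carrierE by blast
  have "C_class P c \<otimes>\<^bsub>CR P\<^esub> ?y = ?y \<otimes>\<^bsub>CR P\<^esub> C_act P (C_class P c) ?d" using c(1)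
  proof (induction c)
    case Nil
    have "C_act P (C_class P []) ?d = C_class P []" using d by (simp add: C_act_class)
    then show ?case using y by (simp flip: C_one)
  next
    case (Cons z c)
    define k l where "k = C_class P [z]" and "l = C_class P c"
    have kl: "k \<in> carrier (CR P)" "l \<in> carrier (CR P)" "C_class P (z # c) = k \<otimes>\<^bsub>CR P\<^esub> l"
      using Cons.hyps by (simp_all add: k_def l_def C_class_closed C_mult)
    have "k \<otimes>\<^bsub>CR P\<^esub> l \<otimes>\<^bsub>CR P\<^esub> ?y = k \<otimes>\<^bsub>CR P\<^esub> ?y \<otimes>\<^bsub>CR P\<^esub> C_act P l ?d"
      using kl y d Cons by (simp add: C.m_assoc C_act_closed l_def)
    also have "\<dots> = ?y \<otimes>\<^bsub>CR P\<^esub> C_act P k ?d \<otimes>\<^bsub>CR P\<^esub> C_act P l ?d"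
      using peiffer_letters[OF assms(1)] Cons by (simp add: k_def)
    also have "\<dots> = ?y \<otimes>\<^bsub>CR P\<^esub> C_act P (k \<otimes>\<^bsub>CR P\<^esub> l) ?d"
      using kl y d by (simp add: C_act_hom C.m_assoc C_act_closed)
    finally show ?case by (simp add: kl(3))
  qed
  then show ?thesis by (simp add: c)
qed

text \<open>The second crossed module axiom, by induction on a word for \<open>l\<close>. The
  element \<open>k\<close> must stay arbitrary, because passing the first letter of \<open>l\<close>
  replaces it by an acted element.\<close>

lemma peiffer_identity:
  assumes "k \<in> carrier (CR P)" "l \<in> carrier (CR P)"
  shows "k \<otimes>\<^bsub>CR P\<^esub> l = l \<otimes>\<^bsub>CR P\<^esub> C_act P k (delta2 P l)"
proof -
  obtain c where c: "c \<in> lists (Ybar P)" "l = C_class P c" using assms C_carrierE by blast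
  have "k \<otimes>\<^bsub>CR P\<^esub> C_class P c = C_class P c \<otimes>\<^bsub>CR P\<^esub> C_act P k (delta P c)"
    using c(1) assms(1)
  proof (induction c arbitrary: k)
    case Nil
    then show ?case by (simp add: delta_Nil C_act_one flip: C_one)
  next
    case (Cons y c)
    define l where "l = C_class P [y]"
    define m where "m = C_class P c"
    have d: "delta_letter P y \<in> carrier (FX P)" "delta P c \<in> carrier (FX P)"
      using Cons by (auto simp: delta_letter_closed delta_closed)
    have lm: "l \<in> carrier (CR P)" "m \<in> carrier (CR P)" "C_class P (y # c) = l \<otimes>\<^bsub>CR P\<^esub> m"
      using Cons.hyps by (simp_all add: l_def m_def C_class_closed C_mult)
    have "k \<otimes>\<^bsub>CR P\<^esub> (l \<otimes>\<^bsub>CR P\<^esub> m) = l \<otimes>\<^bsub>CR P\<^esub> (C_act P k (delta_letter P y) \<otimes>\<^bsub>CR P\<^esub> m)"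
      using peiffer_letter[of y k] Cons lm d
      by (simp add: l_def C_act_closed flip: C.m_assoc)
    also have "\<dots> = l \<otimes>\<^bsub>CR P\<^esub> (m \<otimes>\<^bsub>CR P\<^esub> C_act P (C_act P k (delta_letter P y)) (delta P c))"
      using Cons.IH[of "C_act P k (delta_letter P y)"] Cons d by (simp add: m_def C_act_closed)
    finally show ?case
      using Cons.prems lm d by (simp add: C_act_mult delta_Cons C.m_assoc C_act_closed)
  qed
  then show ?thesis by (simp add: c delta2_class)
qed

end

section \<open>Identities among relations\<close>

context presentation
begin

lemma relator_closure_normal: "relator_closure P \<lhd> FX P"
proof -
  let ?A = "{N. N \<lhd> FX P \<and> relator P ` labels P \<subseteq> N}"
  \<comment> \<open>The whole free group belongs to the family, which is therefore nonempty, and its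
    intersection is a subgroup.\<close>
  have "carrier (FX P) \<lhd> FX P"
    by (rule F.normal_invI) (auto simp: F.subgroup_self)
  then have "?A \<noteq> {}" using relator_closed by blast
  then have "subgroup (\<Inter>?A) (FX P)"
    by (intro F.subgroups_Inter) (auto dest: normal_imp_subgroup)
  then show ?thesis
    unfolding relator_closure_def
    by (rule F.normal_invI) (auto dest: F.normal_invE(2))
qed

sublocale N: normal "relator_closure P" "FX P"
  by (rule relator_closure_normal)

sublocale G: group "grp_of P"
  unfolding grp_of_def by (rule N.factorgroup_is_group)

sublocale phi: group_hom "FX P" "grp_of P" "quot_map P"
  by unfold_locales
    (use N.r_coset_hom_Mod in \<open>simp add: grp_of_def quot_map_def[abs_def]\<close>)

lemma carrier_grp_of: "carrier (grp_of P) = quot_map P ` carrier (FX P)"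
  by (auto simp: grp_of_def FactGroup_def RCOSETS_def quot_map_def)

lemma grp_ofE:
  assumes "g \<in> carrier (grp_of P)"
  obtains u where "u \<in> carrier (FX P)" "g = quot_map P u"
  using assms carrier_grp_of by auto

lemma quot_map_eq_one: "u \<in> relator_closure P \<Longrightarrow> quot_map P u = \<one>\<^bsub>grp_of P\<^esub>"
  using F.coset_join2[OF _ N.subgroup_axioms] N.mem_carrier
  by (auto simp: quot_map_def grp_of_def FactGroup_def)

lemma relator_in_closure: "\<rho> \<in> labels P \<Longrightarrow> relator P \<rho> \<in> relator_closure P"
  by (auto simp: relator_closure_def)

lemma quot_map_relator: "\<rho> \<in> labels P \<Longrightarrow> quot_map P (relator P \<rho>) = \<one>\<^bsub>grp_of P\<^esub>"
  by (simp add: quot_map_eq_one relator_in_closure)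

lemma quot_map_delta:
  assumes "k \<in> carrier (CR P)"
  shows "quot_map P (delta2 P k) = \<one>\<^bsub>grp_of P\<^esub>"
proof -
  have letter: "quot_map P (delta_letter P y) = \<one>\<^bsub>grp_of P\<^esub>" if "y \<in> Ybar P" for y
  proof -
    obtain \<rho> u s where y: "y = ((\<rho>, u), s)" by (metis surj_pair)
    then show ?thesis using that by (simp add: relator_closed quot_map_relator)
  qed
  obtain c where c: "c \<in> lists (Ybar P)" "k = C_class P c" using assms C_carrierE by blast
  have "quot_map P (delta P c) = \<one>\<^bsub>grp_of P\<^esub>" using c(1)
    by induction (simp_all add: delta_Nil delta_Cons letter delta_letter_closed delta_closed)
  then show ?thesis by (simp add: c delta2_class)
qed

text \<open>The boundaries form a normal subgroup, since conjugation of a boundary is the boundary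
  of an acted element, and a relator is the boundary of its letter with trivial exponent. By
  minimality the normal closure is contained in it.\<close>

lemma relator_closure_subset: "relator_closure P \<subseteq> delta2 P ` carrier (CR P)"
proof -
  have "delta2 P ` carrier (CR P) \<lhd> FX P"
  proof (rule F.normal_invI[OF delta2.img_is_subgroup])
    fix v h assume v: "v \<in> carrier (FX P)" and "h \<in> delta2 P ` carrier (CR P)"
    then obtain k where k: "k \<in> carrier (CR P)" "h = delta2 P k" by blast
    have "v \<otimes>\<^bsub>FX P\<^esub> h \<otimes>\<^bsub>FX P\<^esub> inv\<^bsub>FX P\<^esub> v = delta2 P (C_act P k (inv\<^bsub>FX P\<^esub> v))"
      using v k by (simp add: delta2_act)
    then show "v \<otimes>\<^bsub>FX P\<^esub> h \<otimes>\<^bsub>FX P\<^esub> inv\<^bsub>FX P\<^esub> v \<in> delta2 P ` carrier (CR P)"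
      using v k by (simp add: C_act_closed)
  qed
  moreover have "relator P \<rho> \<in> delta2 P ` carrier (CR P)" if "\<rho> \<in> labels P" for \<rho>
  proof -
    have "relator P \<rho> = delta2 P (C_class P [((\<rho>, \<one>\<^bsub>FX P\<^esub>), True)])"
      using that by (simp add: delta2_class delta_Cons delta_Nil relator_closed)
    then show ?thesis using that by (simp add: C_class_closed)
  qed
  ultimately show ?thesis unfolding relator_closure_def by blast
qed

section \<open>The module structure of the identities\<close>

lemma mem_Pi2: "k \<in> carrier (Pi2 P) \<longleftrightarrow> k \<in> carrier (CR P) \<and> delta2 P k = \<one>\<^bsub>FX P\<^esub>"
  by (simp add: Pi2_def kernel_def)

lemma Pi2_subgroup: "subgroup (carrier (Pi2 P)) (CR P)"
  using delta2.subgroup_kernel by (simp add: Pi2_def)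

lemma Pi2_eq: "Pi2 P = (CR P)\<lparr>carrier := carrier (Pi2 P)\<rparr>"
  by (simp add: Pi2_def)

text \<open>In the Peiffer identity with \<open>k\<close> as right factor, the other factor is acted
  on by the boundary of \<open>k\<close>, which is trivial.\<close>

lemma Pi2_central:
  assumes "k \<in> carrier (Pi2 P)" "l \<in> carrier (CR P)"
  shows "k \<otimes>\<^bsub>CR P\<^esub> l = l \<otimes>\<^bsub>CR P\<^esub> k"
  using peiffer_identity[of l k] assms by (simp add: mem_Pi2 C_act_one)

text \<open>In the Peiffer identity with \<open>k\<close> as left factor, centrality allows
  \<open>l\<close> to be cancelled. As every element of the normal closure is a boundary, the action
  on \<open>Pi2\<close> factors through G.\<close>

lemma Pi2_act_delta:
  assumes k: "k \<in> carrier (Pi2 P)" and l: "l \<in> carrier (CR P)"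
  shows "C_act P k (delta2 P l) = k"
proof -
  have "l \<otimes>\<^bsub>CR P\<^esub> C_act P k (delta2 P l) = l \<otimes>\<^bsub>CR P\<^esub> k"
    using peiffer_identity[of k l] Pi2_central[of k l] k l by (simp add: mem_Pi2)
  then show ?thesis using k l by (simp add: mem_Pi2 C_act_closed)
qed

lemma comm_group_Pi2: "comm_group (Pi2 P)"
proof -
  interpret group "Pi2 P"
    using C.subgroup_imp_group[OF Pi2_subgroup] by (simp flip: Pi2_eq)
  show ?thesis
  proof
    fix x y assume "x \<in> carrier (Pi2 P)" "y \<in> carrier (Pi2 P)"
    then have "x \<otimes>\<^bsub>CR P\<^esub> y = y \<otimes>\<^bsub>CR P\<^esub> x"
      by (intro Pi2_central) (simp_all add: mem_Pi2)
    then show "x \<otimes>\<^bsub>Pi2 P\<^esub> y = y \<otimes>\<^bsub>Pi2 P\<^esub> x"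
      by (simp add: Pi2_def)
  qed
qed

sublocale Pi2: comm_group "Pi2 P"
  by (rule comm_group_Pi2)

text \<open>Two members of the coset differ by an element of the normal closure. That element is a
  boundary and acts trivially, so the image taken in \<open>Pi2_act\<close> is a singleton.\<close>

lemma Pi2_act_eq:
  assumes k: "k \<in> carrier (Pi2 P)" and u: "u \<in> carrier (FX P)"
  shows "Pi2_act P k (quot_map P u) = C_act P k u"
proof -
  have "C_act P k v = C_act P k u" if v: "v \<in> quot_map P u" for v
  proof -
    obtain n where n: "n \<in> relator_closure P" "v = n \<otimes>\<^bsub>FX P\<^esub> u"
      using v by (auto simp: quot_map_def r_coset_def)
    obtain l where l: "l \<in> carrier (CR P)" "n = delta2 P l"
      using n relator_closure_subset by blast
    have "C_act P k v = C_act P (C_act P k n) u"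
      using n l k u by (simp add: C_act_mult mem_Pi2)
    then show ?thesis using Pi2_act_delta[OF k l(1)] l(2) by simp
  qed
  moreover have "u \<in> quot_map P u"
    using u F.rcos_self[OF u N.subgroup_axioms] by (simp add: quot_map_def)
  ultimately have "C_act P k ` quot_map P u = {C_act P k u}" by blast
  then show ?thesis by (simp add: Pi2_act_def)
qed

lemma Pi2_act_closed:
  assumes "k \<in> carrier (Pi2 P)" "g \<in> carrier (grp_of P)"
  shows "Pi2_act P k g \<in> carrier (Pi2 P)"
proof -
  obtain u where "u \<in> carrier (FX P)" "g = quot_map P u" using assms grp_ofE by blast
  then show ?thesis
    using assms by (simp add: Pi2_act_eq) (simp add: mem_Pi2 C_act_closed delta2_act)
qed

text \<open>Serves to keep the intersection in \<open>generates_Pi2\<close> inside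
  \<open>Pi2\<close>.\<close>

lemma Pi2_submodule_carrier: "Pi2_submodule P (carrier (Pi2 P))"
proof -
  have "Pi2_scale P k a \<in> carrier (Pi2 P)"
    if "k \<in> carrier (Pi2 P)" "a \<in> int_group_ring (grp_of P)" for k a
    unfolding Pi2_scale_def using that
    by (intro Pi2.finprod_closed)
      (auto simp: int_group_ring_def subset_iff intro!: Pi2.int_pow_closed Pi2_act_closed)
  then show ?thesis by (simp add: Pi2_submodule_def Pi2.subgroup_self)
qed

text \<open>Each submodule of \<open>Pi2\<close> is in particular a subgroup of C(R), so it is
  enough to show that \<open>S\<close> generates \<open>Pi2\<close> as a group.\<close>

lemma generates_Pi2I:
  assumes "S \<subseteq> carrier (Pi2 P)"
    and "\<And>M. subgroup M (CR P) \<Longrightarrow> S \<subseteq> M \<Longrightarrow> carrier (Pi2 P) \<subseteq> M"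
  shows "generates_Pi2 P S"
proof -
  have "carrier (Pi2 P) \<subseteq> M" if "Pi2_submodule P M" "S \<subseteq> M" for M
  proof (rule assms(2)[OF _ that(2)])
    have "subgroup M ((CR P)\<lparr>carrier := carrier (Pi2 P)\<rparr>)"
      using that(1) by (simp add: Pi2_submodule_def flip: Pi2_eq)
    then show "subgroup M (CR P)" by (rule C.incl_subgroup[OF Pi2_subgroup])
  qed
  then show ?thesis
    unfolding generates_Pi2_def using assms(1) Pi2_submodule_carrier by blast
qed

lemma C_class_letter_inv:
  assumes "y \<in> Ybar P"
  shows "C_class P [letter_inv y] = inv\<^bsub>CR P\<^esub> C_class P [y]"
proof -
  have *: "C_class P [y] \<otimes>\<^bsub>CR P\<^esub> C_class P [letter_inv y] = \<one>\<^bsub>CR P\<^esub>"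
    using assms Y.cl_rule[OF peiffer_ruleI(2)[OF assms]] by (simp add: C_mult C_one)
  show ?thesis
    using assms by (intro C.inv_equality[OF C.inv_comm[OF *], symmetric]) (simp_all add: C_class_closed)
qed

end

text \<open>Isolates the properties of \<open>k1\<close> on which the generation argument rests;
  \<open>log_derivation_path\<close> supplies the instance. \<open>K_mult\<close> expresses that the
  path \<open>[g, u v]\<close> is \<open>[g, u]\<close> followed by \<open>v\<close> from the vertex
  reached.\<close>

locale log_derivation = presentation P
  for P :: "('x, 'r) grp_presentation" +
  fixes s :: "'x free_elt set \<Rightarrow> 'x free_elt"
    and K :: "'x free_elt set \<Rightarrow> 'x free_elt \<Rightarrow> ('x, 'r) C_elt"
  assumes s_closed: "g \<in> carrier (grp_of P) \<Longrightarrow> s g \<in> carrier (FX P)"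
    and s_one: "s \<one>\<^bsub>grp_of P\<^esub> = \<one>\<^bsub>FX P\<^esub>"
    and K_closed: "g \<in> carrier (grp_of P) \<Longrightarrow> u \<in> carrier (FX P) \<Longrightarrow> K g u \<in> carrier (CR P)"
    and K_mult: "g \<in> carrier (grp_of P) \<Longrightarrow> u \<in> carrier (FX P) \<Longrightarrow> v \<in> carrier (FX P) \<Longrightarrow>
      K g (u \<otimes>\<^bsub>FX P\<^esub> v) = K g u \<otimes>\<^bsub>CR P\<^esub> K (g \<otimes>\<^bsub>grp_of P\<^esub> quot_map P u) v"
    and delta2_K: "g \<in> carrier (grp_of P) \<Longrightarrow> u \<in> carrier (FX P) \<Longrightarrow>
      delta2 P (K g u) =
        s g \<otimes>\<^bsub>FX P\<^esub> u \<otimes>\<^bsub>FX P\<^esub> inv\<^bsub>FX P\<^esub> s (g \<otimes>\<^bsub>grp_of P\<^esub> quot_map P u)"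
begin

definition iota :: "'x free_elt set \<Rightarrow> 'r \<Rightarrow> ('x, 'r) C_elt" where
  "iota g \<rho> = C_class P [((\<rho>, inv\<^bsub>FX P\<^esub> (s g)), False)] \<otimes>\<^bsub>CR P\<^esub> K g (relator P \<rho>)"

abbreviation K1 :: "'x free_elt \<Rightarrow> ('x, 'r) C_elt" where "K1 \<equiv> K \<one>\<^bsub>grp_of P\<^esub>"

text \<open>Compares \<open>k\<close> with the lift of its boundary along \<open>K1\<close>. With
  the inverse in front, the map is inversion on \<open>Pi2\<close> instead of the identity.\<close>

definition retr :: "('x, 'r) C_elt \<Rightarrow> ('x, 'r) C_elt" where
  "retr k = inv\<^bsub>CR P\<^esub> k \<otimes>\<^bsub>CR P\<^esub> K1 (delta2 P k)"

text \<open>The trivial path composed with itself is itself, so its value is an idempotent of the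
  group C(R).\<close>

lemma K_one: "g \<in> carrier (grp_of P) \<Longrightarrow> K g \<one>\<^bsub>FX P\<^esub> = \<one>\<^bsub>CR P\<^esub>"
  using K_mult[of g "\<one>\<^bsub>FX P\<^esub>" "\<one>\<^bsub>FX P\<^esub>"] K_closed[of g "\<one>\<^bsub>FX P\<^esub>"] by simp

text \<open>The path along the inverse of \<open>u\<close> from 1 ends at the vertex used here, and
  following \<open>u\<close> from there retraces it.\<close>

lemma K_inv:
  assumes u: "u \<in> carrier (FX P)"
  shows "K (quot_map P (inv\<^bsub>FX P\<^esub> u)) u = inv\<^bsub>CR P\<^esub> K1 (inv\<^bsub>FX P\<^esub> u)"
proof -
  have *: "K1 (inv\<^bsub>FX P\<^esub> u) \<otimes>\<^bsub>CR P\<^esub> K (quot_map P (inv\<^bsub>FX P\<^esub> u)) u = \<one>\<^bsub>CR P\<^esub>"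
    using K_mult[of "\<one>\<^bsub>grp_of P\<^esub>" "inv\<^bsub>FX P\<^esub> u" u] u by (simp add: K_one del: phi.hom_inv)
  show ?thesis
    using u by (intro C.inv_equality[OF C.inv_comm[OF *], symmetric])
      (simp_all add: K_closed del: phi.hom_inv)
qed

text \<open>A relator is a closed path at \<open>g\<close>, so the boundary of its value is the
  relator conjugated by the inverse of \<open>s g\<close>. The letter in front has exactly the
  inverse boundary.\<close>

lemma iota_in_Pi2:
  assumes "g \<in> carrier (grp_of P)" "\<rho> \<in> labels P"
  shows "iota g \<rho> \<in> carrier (Pi2 P)"
proof -
  define r where "r = relator P \<rho>"
  have r: "r \<in> carrier (FX P)" "quot_map P r = \<one>\<^bsub>grp_of P\<^esub>"
    using assms by (simp_all add: r_def relator_closed quot_map_relator)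
  have "delta2 P (C_class P [((\<rho>, inv\<^bsub>FX P\<^esub> (s g)), False)]) =
      s g \<otimes>\<^bsub>FX P\<^esub> inv\<^bsub>FX P\<^esub> r \<otimes>\<^bsub>FX P\<^esub> inv\<^bsub>FX P\<^esub> s g"
    using assms r by (simp add: delta2_class delta_Cons delta_Nil s_closed flip: r_def)
  moreover have "delta2 P (K g r) = s g \<otimes>\<^bsub>FX P\<^esub> r \<otimes>\<^bsub>FX P\<^esub> inv\<^bsub>FX P\<^esub> s g"
    using assms r by (simp add: delta2_K)
  moreover have "s g \<otimes>\<^bsub>FX P\<^esub> inv\<^bsub>FX P\<^esub> r \<otimes>\<^bsub>FX P\<^esub> inv\<^bsub>FX P\<^esub> s g \<otimes>\<^bsub>FX P\<^esub>
      (s g \<otimes>\<^bsub>FX P\<^esub> r \<otimes>\<^bsub>FX P\<^esub> inv\<^bsub>FX P\<^esub> s g) = \<one>\<^bsub>FX P\<^esub>"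
  proof -
    have "s g \<otimes>\<^bsub>FX P\<^esub> inv\<^bsub>FX P\<^esub> r \<otimes>\<^bsub>FX P\<^esub> inv\<^bsub>FX P\<^esub> s g =
        inv\<^bsub>FX P\<^esub> (s g \<otimes>\<^bsub>FX P\<^esub> r \<otimes>\<^bsub>FX P\<^esub> inv\<^bsub>FX P\<^esub> s g)"
      using r s_closed[OF assms(1)] by (simp add: F.inv_mult_group F.m_assoc)
    then show ?thesis using r s_closed[OF assms(1)] by simp
  qed
  moreover have "C_class P [((\<rho>, inv\<^bsub>FX P\<^esub> (s g)), False)] \<in> carrier (CR P)"
    using assms by (simp add: C_class_closed s_closed)
  ultimately show ?thesis
    using assms r by (simp add: mem_Pi2 iota_def K_closed flip: r_def)
qed

lemma retr_in_Pi2: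
  assumes "k \<in> carrier (CR P)"
  shows "retr k \<in> carrier (Pi2 P)"
proof -
  \<comment> \<open>A boundary is trivial in G, hence a closed path at 1. Both outer factors in
    \<open>delta2_K\<close> then come from \<open>s\<close> at 1 and vanish by
    \<open>s_one\<close>.\<close>
  have "delta2 P (K1 (delta2 P k)) = delta2 P k"
    using assms by (simp add: delta2_K quot_map_delta s_one)
  then show ?thesis using assms by (simp add: mem_Pi2 retr_def K_closed)
qed

text \<open>\<open>K1\<close> is multiplicative on boundaries because, these being closed paths at
  1, the second path starts at 1 again. Inverting the product leaves \<open>retr k\<close> between
  \<open>inv l\<close> and the lift of the boundary of \<open>l\<close>; being central it can be
  moved to the front.\<close>

lemma retr_hom: "retr \<in> hom (CR P) (CR P)"
proof (rule homI)
  fix k l assume kl: "k \<in> carrier (CR P)" "l \<in> carrier (CR P)"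
  let ?k = "K1 (delta2 P k)" and ?l = "K1 (delta2 P l)"
  have K: "?k \<in> carrier (CR P)" "?l \<in> carrier (CR P)"
    using kl by (simp_all add: K_closed)
  have r: "retr k \<in> carrier (CR P)" using kl K by (simp add: retr_def)
  have "retr (k \<otimes>\<^bsub>CR P\<^esub> l) = inv\<^bsub>CR P\<^esub> l \<otimes>\<^bsub>CR P\<^esub> retr k \<otimes>\<^bsub>CR P\<^esub> ?l"
    using kl K by (simp add: retr_def K_mult quot_map_delta C.inv_mult_group C.m_assoc)
  also have "\<dots> = retr k \<otimes>\<^bsub>CR P\<^esub> inv\<^bsub>CR P\<^esub> l \<otimes>\<^bsub>CR P\<^esub> ?l"
    using Pi2_central[OF retr_in_Pi2[OF kl(1)], of "inv\<^bsub>CR P\<^esub> l"] kl by simp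
  also have "\<dots> = retr k \<otimes>\<^bsub>CR P\<^esub> retr l"
    using kl K r by (simp add: retr_def[of l] C.m_assoc)
  finally show "retr (k \<otimes>\<^bsub>CR P\<^esub> l) = retr k \<otimes>\<^bsub>CR P\<^esub> retr l" .
qed (use retr_in_Pi2 mem_Pi2 in blast)

sublocale retr: group_hom "CR P" "CR P" retr
  by unfold_locales (rule retr_hom)

lemma retr_Pi2: "k \<in> carrier (Pi2 P) \<Longrightarrow> retr k = inv\<^bsub>CR P\<^esub> k"
  by (simp add: mem_Pi2 retr_def K_one)

lemma retr_letter:
  assumes \<rho>: "\<rho> \<in> labels P" and u: "u \<in> carrier (FX P)"
  shows "retr (C_class P [((\<rho>, u), True)]) = iota (quot_map P (inv\<^bsub>FX P\<^esub> u)) \<rho>"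
proof -
  define r where "r = relator P \<rho>"
  define g where "g = quot_map P (inv\<^bsub>FX P\<^esub> u)"
  define h where "h = K1 (inv\<^bsub>FX P\<^esub> u)"
  define y where "y = C_class P [((\<rho>, u), False)]"
  have r: "r \<in> carrier (FX P)" "quot_map P r = \<one>\<^bsub>grp_of P\<^esub>"
    using \<rho> by (simp_all add: r_def relator_closed quot_map_relator)
  have g: "g \<in> carrier (grp_of P)" using u by (simp add: g_def)
  have h: "h \<in> carrier (CR P)" using u by (simp add: h_def K_closed)
  have y: "y \<in> carrier (CR P)" using \<rho> u by (simp add: y_def C_class_closed)
  have Kr: "K g r \<in> carrier (CR P)" using g r by (simp add: K_closed)
  have "K1 (delta2 P (C_class P [((\<rho>, u), True)])) = K1 (inv\<^bsub>FX P\<^esub> u \<otimes>\<^bsub>FX P\<^esub> r \<otimes>\<^bsub>FX P\<^esub> u)"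
    using \<rho> u r by (simp add: delta2_class delta_Cons delta_Nil flip: r_def)
  \<comment> \<open>The path goes from 1 to \<open>g\<close>, runs once around the relator, and
    returns to 1.\<close>
  also have "\<dots> = h \<otimes>\<^bsub>CR P\<^esub> K g r \<otimes>\<^bsub>CR P\<^esub> K g u"
    using u r by (simp add: K_mult h_def g_def)
  also have "K g u = inv\<^bsub>CR P\<^esub> h"
    using K_inv[OF u] by (simp only: g_def h_def)
  finally have "retr (C_class P [((\<rho>, u), True)]) =
      y \<otimes>\<^bsub>CR P\<^esub> (h \<otimes>\<^bsub>CR P\<^esub> K g r \<otimes>\<^bsub>CR P\<^esub> inv\<^bsub>CR P\<^esub> h)"
    using C_class_letter_inv[of "((\<rho>, u), True)"] \<rho> u by (simp add: retr_def y_def)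
  also have "\<dots> = (y \<otimes>\<^bsub>CR P\<^esub> h) \<otimes>\<^bsub>CR P\<^esub> (K g r \<otimes>\<^bsub>CR P\<^esub> inv\<^bsub>CR P\<^esub> h)"
    using y h Kr by (simp add: C.m_assoc)
  \<comment> \<open>Moving the letter past \<open>h\<close> multiplies its exponent \<open>u\<close>
    by the boundary of \<open>h\<close>. The factors \<open>inv u\<close> and \<open>u\<close>
    cancel, and the exponent occurring in \<open>iota\<close> remains.\<close>
  also have "y \<otimes>\<^bsub>CR P\<^esub> h = h \<otimes>\<^bsub>CR P\<^esub> C_act P y (delta2 P h)"
    using y h by (rule peiffer_identity)
  also have "C_act P y (delta2 P h) = C_class P [((\<rho>, inv\<^bsub>FX P\<^esub> (s g)), False)]"
  proof -
    have "delta2 P h = inv\<^bsub>FX P\<^esub> u \<otimes>\<^bsub>FX P\<^esub> inv\<^bsub>FX P\<^esub> s g"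
      using u s_closed[OF g] by (simp add: h_def delta2_K s_one g_def del: phi.hom_inv)
    moreover have "u \<otimes>\<^bsub>FX P\<^esub> (inv\<^bsub>FX P\<^esub> u \<otimes>\<^bsub>FX P\<^esub> inv\<^bsub>FX P\<^esub> s g) = inv\<^bsub>FX P\<^esub> s g"
      using u s_closed[OF g] by (simp flip: F.m_assoc)
    ultimately show ?thesis
      using u s_closed[OF g] by (simp add: y_def C_act_class)
  qed
  also have "h \<otimes>\<^bsub>CR P\<^esub> C_class P [((\<rho>, inv\<^bsub>FX P\<^esub> (s g)), False)] \<otimes>\<^bsub>CR P\<^esub>
      (K g r \<otimes>\<^bsub>CR P\<^esub> inv\<^bsub>CR P\<^esub> h) = h \<otimes>\<^bsub>CR P\<^esub> iota g \<rho> \<otimes>\<^bsub>CR P\<^esub> inv\<^bsub>CR P\<^esub> h"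
    using h Kr \<rho> s_closed[OF g] by (simp add: iota_def C.m_assoc C_class_closed flip: r_def)
  \<comment> \<open>Conjugation by \<open>h\<close> has no effect, since
    \<open>iota g \<rho>\<close> is central.\<close>
  also have "h \<otimes>\<^bsub>CR P\<^esub> iota g \<rho> = iota g \<rho> \<otimes>\<^bsub>CR P\<^esub> h"
    using Pi2_central[OF iota_in_Pi2[OF g \<rho>] h] by simp
  also have "iota g \<rho> \<otimes>\<^bsub>CR P\<^esub> h \<otimes>\<^bsub>CR P\<^esub> inv\<^bsub>CR P\<^esub> h = iota g \<rho>"
    using iota_in_Pi2[OF g \<rho>] h by (simp add: mem_Pi2 C.m_assoc)
  finally show ?thesis by (simp only: g_def)
qed

theorem iota_generates_Pi2:
  "generates_Pi2 P {iota g \<rho> | g \<rho>. g \<in> carrier (grp_of P) \<and> \<rho> \<in> labels P}" (is "generates_Pi2 P ?S")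
proof (rule generates_Pi2I)
  show "?S \<subseteq> carrier (Pi2 P)" using iota_in_Pi2 by blast
next
  fix M assume M: "subgroup M (CR P)" "?S \<subseteq> M"
  \<comment> \<open>The vertex of the matching generator is read off from the exponent: it is the
    image of \<open>inv u\<close> in G.\<close>
  have pos: "retr (C_class P [((\<rho>, u), True)]) \<in> M" if "\<rho> \<in> labels P" "u \<in> carrier (FX P)" for \<rho> u
  proof -
    have "quot_map P (inv\<^bsub>FX P\<^esub> u) \<in> carrier (grp_of P)"
      using that by simp
    then have "iota (quot_map P (inv\<^bsub>FX P\<^esub> u)) \<rho> \<in> M" using that(1) M(2) by blast
    then show ?thesis by (simp only: retr_letter[OF that])
  qed
  have letter: "retr (C_class P [y]) \<in> M" if "y \<in> Ybar P" for y
  proof -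
    obtain \<rho> u e where y: "y = ((\<rho>, u), e)" by (metis surj_pair)
    have "retr (inv\<^bsub>CR P\<^esub> C_class P [((\<rho>, u), True)]) \<in> M"
      using that pos[of \<rho> u] subgroup.m_inv_closed[OF M(1)] by (simp add: y C_class_closed)
    then show ?thesis
      using that pos C_class_letter_inv[of "((\<rho>, u), True)"] by (cases e) (simp_all add: y)
  qed
  have word: "retr (C_class P c) \<in> M" if "c \<in> lists (Ybar P)" for c
    using that
  proof induction
    case Nil
    then show ?case using subgroup.one_closed[OF M(1)] by (simp flip: C_one)
  next
    case (Cons y c)
    have "C_class P (y # c) = C_class P [y] \<otimes>\<^bsub>CR P\<^esub> C_class P c"
      using Cons.hyps by (simp add: C_mult)
    then have "retr (C_class P (y # c)) = retr (C_class P [y]) \<otimes>\<^bsub>CR P\<^esub> retr (C_class P c)"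
      using Cons.hyps by (simp add: C_class_closed)
    then show ?case
      using letter[OF Cons.hyps(1)] Cons.IH subgroup.m_closed[OF M(1)] by simp
  qed
  show "carrier (Pi2 P) \<subseteq> M"
  proof
    fix k assume k: "k \<in> carrier (Pi2 P)"
    then have kC: "k \<in> carrier (CR P)" by (simp add: mem_Pi2)
    then obtain c where "c \<in> lists (Ybar P)" "k = C_class P c" by (rule C_carrierE)
    \<comment> \<open>On \<open>Pi2\<close> the map \<open>retr\<close> is inversion, so
      \<open>k\<close> is the inverse of an element of \<open>M\<close>.\<close>
    then have "inv\<^bsub>CR P\<^esub> k \<in> M" using word[of c] retr_Pi2[OF k] by simp
    then have "inv\<^bsub>CR P\<^esub> (inv\<^bsub>CR P\<^esub> k) \<in> M" by (rule subgroup.m_inv_closed[OF M(1)])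
    then show "k \<in> M" using kC by simp
  qed
qed

end

section \<open>Morphisms out of free groupoids\<close>

lemma bar_graph_simps [simp]:
  "verts (bar_graph \<Gamma>) = verts \<Gamma>" "arcs (bar_graph \<Gamma>) = bar (arcs \<Gamma>)"
  "tail (bar_graph \<Gamma>) (e, True) = tail \<Gamma> e" "tail (bar_graph \<Gamma>) (e, False) = head \<Gamma> e"
  "head (bar_graph \<Gamma>) (e, True) = head \<Gamma> e" "head (bar_graph \<Gamma>) (e, False) = tail \<Gamma> e"
  by (simp_all add: bar_graph_def)

lemma bar_graph_letter_inv [simp]:
  "tail (bar_graph \<Gamma>) (letter_inv e) = head (bar_graph \<Gamma>) e"
  "head (bar_graph \<Gamma>) (letter_inv e) = tail (bar_graph \<Gamma>) e"
  by (cases e; cases "snd e"; simp)+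

context wf_digraph
begin

abbreviation zigzag :: "'a \<Rightarrow> ('b \<times> bool) list \<Rightarrow> 'a \<Rightarrow> bool" where
  "zigzag \<equiv> pre_digraph.awalk (bar_graph G)"

text \<open>Fixing the ends and requiring both sides to be walks matters: read backwards,
  \<open>rstep\<close> alone could insert an edge and its inverse at a vertex where that edge does
  not start.\<close>

abbreviation zigzag_step :: "'a \<Rightarrow> 'a \<Rightarrow> ('b \<times> bool) list \<Rightarrow> ('b \<times> bool) list \<Rightarrow> bool" where
  "zigzag_step u v \<equiv> (\<lambda>p q. zigzag u p v \<and> zigzag u q v \<and>
    rstep (bar (arcs G)) (cancel_rules (arcs G)) p q)"

lemma wf_bar_graph: "wf_digraph (bar_graph G)"
proof
  fix e assume "e \<in> arcs (bar_graph G)"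
  then show "tail (bar_graph G) e \<in> verts (bar_graph G)" "head (bar_graph G) e \<in> verts (bar_graph G)"
    by (cases e; cases "snd e"; simp)+
qed

lemma zigzag_Nil: "zigzag u [] v \<longleftrightarrow> u = v \<and> u \<in> verts G"
  using wf_digraph.awalk_Nil_iff[OF wf_bar_graph] by simp

lemma zigzag_Cons:
  "zigzag u (e # p) v \<longleftrightarrow>
    e \<in> bar (arcs G) \<and> u = tail (bar_graph G) e \<and> zigzag (head (bar_graph G) e) p v"
  using wf_digraph.awalk_Cons_iff[OF wf_bar_graph] by simp

lemma zigzag_single:
  assumes "e \<in> bar (arcs G)"
  shows "zigzag (tail (bar_graph G) e) [e] (head (bar_graph G) e)"
proof -
  have "head (bar_graph G) e \<in> verts G"
    using assms wf_digraph.head_in_verts[OF wf_bar_graph] by simp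
  then show ?thesis using assms by (simp add: zigzag_Cons zigzag_Nil)
qed

lemma zigzag_append: "zigzag u p v \<Longrightarrow> zigzag v q w \<Longrightarrow> zigzag u (p @ q) w"
  by (rule wf_digraph.awalk_appendI[OF wf_bar_graph])

lemma zigzag_in_lists: "zigzag u p v \<Longrightarrow> p \<in> lists (bar (arcs G))"
  by (induction p arbitrary: u) (auto simp: zigzag_Cons)

lemma zigzag_equiv: "equivclp (zigzag_step u v) p q \<Longrightarrow> zigzag u p v \<longleftrightarrow> zigzag u q v"
  using equivclp_invariant[of "zigzag_step u v" p q "\<lambda>p. zigzag u p v"] by simp

lemma mem_walk_class: "q \<in> walk_class G u p v \<longleftrightarrow> equivclp (zigzag_step u v) p q"
  by (simp add: walk_class_def)

lemma zigzag_trans: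
  "equivclp (zigzag_step u v) p q \<Longrightarrow> equivclp (zigzag_step u v) q r \<Longrightarrow>
    equivclp (zigzag_step u v) p r"
  by (rule transpD[OF transp_equivclp])

lemma walk_class_eq:
  assumes "equivclp (zigzag_step u v) p q"
  shows "walk_class G u p v = walk_class G u q v"
  using zigzag_trans[OF assms] zigzag_trans[OF equivclp_sym[OF assms]]
  by (auto simp: set_eq_iff mem_walk_class)

lemma zigzag_step_context:
  assumes "zigzag_step u v p q" "zigzag t a u" "zigzag v b w"
  shows "zigzag_step t w (a @ p @ b) (a @ q @ b)"
  using assms string_rewriting.rstep_context[OF free_string_rewriting] zigzag_in_lists
  by (intro conjI zigzag_append) blast+

lemma zigzag_equiv_context:
  assumes "equivclp (zigzag_step u v) p q" "zigzag t a u" "zigzag v b w"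
  shows "equivclp (zigzag_step t w) (a @ p @ b) (a @ q @ b)"
  using assms(1)
proof induction
  case base
  show ?case by (rule equivclp_refl)
next
  case (step q r)
  have "equivclp (zigzag_step t w) (a @ q @ b) (a @ r @ b)"
    using step(2)
  proof
    assume "zigzag_step u v q r"
    from zigzag_step_context[OF this assms(2,3)] show ?thesis by (rule r_into_equivclp)
  next
    assume "zigzag_step u v r q"
    from zigzag_step_context[OF this assms(2,3)] show ?thesis by (rule converse_r_into_equivclp)
  qed
  with step(3) show ?case by (rule zigzag_trans)
qed

lemma free_groupoid_simps [simp]:
  "gobj (free_groupoid G) = verts G" "gsrc (free_groupoid G) = fst"
  "gtgt (free_groupoid G) = snd \<circ> snd"
  "gid (free_groupoid G) = (\<lambda>u. (u, walk_class G u [] u, u))"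
  by (simp_all add: free_groupoid_def)

lemma garrI: "zigzag u p v \<Longrightarrow> (u, walk_class G u p v, v) \<in> garr (free_groupoid G)"
  by (auto simp: free_groupoid_def)

lemma garrE:
  assumes "a \<in> garr (free_groupoid G)"
  obtains u p v where "zigzag u p v" "a = (u, walk_class G u p v, v)"
  using assms by (auto simp: free_groupoid_def)

text \<open>The classes in the union defining composition coincide. The first factor is changed
  before the second, and \<open>zigzag_equiv\<close> ensures that the new first factor is still a
  walk with the same ends.\<close>

lemma gcomp_class:
  assumes p: "zigzag u p v" and q: "zigzag v q w"
  shows "gcomp (free_groupoid G) (u, walk_class G u p v, v) (v, walk_class G v q w, w) =
    (u, walk_class G u (p @ q) w, w)"
proof -
  have eq: "walk_class G u (p' @ q') w = walk_class G u (p @ q) w"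
    if p': "p' \<in> walk_class G u p v" and q': "q' \<in> walk_class G v q w" for p' q'
  proof (rule walk_class_eq[symmetric])
    have pp: "equivclp (zigzag_step u v) p p'" and qq: "equivclp (zigzag_step v w) q q'"
      using that by (simp_all only: mem_walk_class)
    have z: "zigzag u p' v" using zigzag_equiv[OF pp] p by simp
    have u: "u \<in> verts G" and w: "w \<in> verts G"
      using wf_digraph.awalk_hd_in_verts[OF wf_bar_graph p]
        wf_digraph.awalk_last_in_verts[OF wf_bar_graph q] by simp_all
    have "equivclp (zigzag_step u w) (p @ q) (p' @ q)"
      using zigzag_equiv_context[OF pp, of u "[]" q w] q u by (simp add: zigzag_Nil)
    moreover have "equivclp (zigzag_step u w) (p' @ q) (p' @ q')"
      using zigzag_equiv_context[OF qq z, of "[]" w] w by (simp add: zigzag_Nil)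
    ultimately show "equivclp (zigzag_step u w) (p @ q) (p' @ q')" by (rule zigzag_trans)
  qed
  have "(\<Union>p'\<in>walk_class G u p v. \<Union>q'\<in>walk_class G v q w. walk_class G u (p' @ q') w) =
      (\<Union>p'\<in>walk_class G u p v. \<Union>q'\<in>walk_class G v q w. walk_class G u (p @ q) w)"
    by (intro SUP_cong refl) (rule eq)
  also have "\<dots> = walk_class G u (p @ q) w"
    using mem_walk_class[of p u p v] mem_walk_class[of q v q w] by auto
  finally show ?thesis by (simp add: free_groupoid_def)
qed

lemma walk_class_cancel:
  assumes "e \<in> bar (arcs G)"
  shows "walk_class G (tail (bar_graph G) e) [e, letter_inv e] (tail (bar_graph G) e) =
    walk_class G (tail (bar_graph G) e) [] (tail (bar_graph G) e)"
proof (rule walk_class_eq[OF r_into_equivclp], intro conjI)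
  have t: "tail (bar_graph G) e \<in> verts G"
    using assms wf_digraph.tail_in_verts[OF wf_bar_graph] by simp
  then show "zigzag (tail (bar_graph G) e) [e, letter_inv e] (tail (bar_graph G) e)"
    "zigzag (tail (bar_graph G) e) [] (tail (bar_graph G) e)"
    using assms by (simp_all add: zigzag_Cons zigzag_Nil)
  show "rstep (bar (arcs G)) (cancel_rules (arcs G)) [e, letter_inv e] []"
    using assms
    by (intro string_rewriting.rule_rstep[OF free_string_rewriting]) (simp add: cancel_rules_def)
qed

end

text \<open>The setting for the universal property of the free groupoid. Since the target has one
  object, end points impose no condition, and any assignment of group elements to edges is
  admissible.\<close>

locale edge_labelling = wf_digraph G + H: group H
  for G :: "('v, 'e) pre_digraph" and H :: "('a, 'm) monoid_scheme" +
  fixes \<kappa> :: "'e \<Rightarrow> 'a"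
  assumes label_closed: "e \<in> arcs G \<Longrightarrow> \<kappa> e \<in> carrier H"
begin

definition letter_val :: "'e \<times> bool \<Rightarrow> 'a" where
  "letter_val = (\<lambda>(e, s). if s then \<kappa> e else inv\<^bsub>H\<^esub> \<kappa> e)"

abbreviation val :: "('e \<times> bool) list \<Rightarrow> 'a" where
  "val \<equiv> word_val H letter_val"

lemma letter_val_closed: "letter_val \<in> bar (arcs G) \<rightarrow> carrier H"
  by (auto simp: letter_val_def bar_def label_closed)

lemma letter_val_inv:
  "e \<in> bar (arcs G) \<Longrightarrow> letter_val (letter_inv e) = inv\<^bsub>H\<^esub> letter_val e"
  by (cases e) (auto simp: letter_val_def label_closed)

lemma val_closed: "zigzag u p v \<Longrightarrow> val p \<in> carrier H"
  by (rule H.word_val_closed[OF letter_val_closed zigzag_in_lists])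

lemma val_append: "zigzag u p v \<Longrightarrow> zigzag v q w \<Longrightarrow> val (p @ q) = val p \<otimes>\<^bsub>H\<^esub> val q"
  by (rule H.word_val_append[OF letter_val_closed zigzag_in_lists zigzag_in_lists])

lemma val_class:
  assumes "q \<in> walk_class G u p v"
  shows "val q = val p"
proof -
  have "val p = val q"
  proof (rule equivclp_invariant[of "zigzag_step u v"])
    show "equivclp (zigzag_step u v) p q" using assms by (simp only: mem_walk_class)
  next
    fix p q assume "zigzag_step u v p q"
    then have "equivclp (rstep (bar (arcs G)) (cancel_rules (arcs G))) p q" by blast
    moreover have "val l = val r" if "(l, r) \<in> cancel_rules (arcs G)" for l r
    proof -
      from that obtain e where e: "e \<in> bar (arcs G)" "l = [e, letter_inv e]" "r = []"
        by (rule cancel_rulesE)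
      then show ?thesis using Pi_mem[OF letter_val_closed] by (simp add: letter_val_inv)
    qed
    ultimately show "val p = val q"
      using H.word_val_equiv[OF cancel_rules_in letter_val_closed] by blast
  qed
  then show ?thesis by simp
qed

text \<open>The restriction to arrows makes this the extensional representative; on an arrow the
  image is a singleton by \<open>val_class\<close>.\<close>

definition val_morphism :: "'v \<times> ('e \<times> bool) list set \<times> 'v \<Rightarrow> 'a" where
  "val_morphism = (\<lambda>a\<in>garr (free_groupoid G). the_elem (val ` fst (snd a)))"

lemma val_morphism_class:
  assumes "zigzag u p v"
  shows "val_morphism (u, walk_class G u p v, v) = val p"
proof -
  have "p \<in> walk_class G u p v" by (simp add: mem_walk_class)
  then have "val ` walk_class G u p v = {val p}"
    using val_class by blast
  then show ?thesis using garrI[OF assms] by (simp add: val_morphism_def)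
qed

definition extends_labels :: "('v \<times> ('e \<times> bool) list set \<times> 'v \<Rightarrow> 'a) \<Rightarrow> bool" where
  "extends_labels k \<longleftrightarrow>
    groupoid_morphism (free_groupoid G) (one_object_groupoid H) (\<lambda>_. ()) k \<and>
    (\<forall>e\<in>arcs G. k (tail G e, walk_class G (tail G e) [(e, True)] (head G e), head G e) = \<kappa> e)"

lemma val_morphism_extends: "extends_labels val_morphism"
  unfolding extends_labels_def groupoid_morphism_def
proof (intro conjI ballI impI)
  fix a assume "a \<in> garr (free_groupoid G)"
  then obtain u p v where a: "zigzag u p v" "a = (u, walk_class G u p v, v)" by (rule garrE)
  fix b assume "b \<in> garr (free_groupoid G)"
    and "gtgt (free_groupoid G) a = gsrc (free_groupoid G) b"
  moreover from this(1) obtain u' q w where "zigzag u' q w" "b = (u', walk_class G u' q w, w)"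
    by (rule garrE)
  ultimately have b: "zigzag v q w" "b = (v, walk_class G v q w, w)"
    using a by simp_all
  show "val_morphism (gcomp (free_groupoid G) a b) =
      gcomp (one_object_groupoid H) (val_morphism a) (val_morphism b)"
    using a b zigzag_append[OF a(1) b(1)]
    by (simp add: gcomp_class val_morphism_class val_append one_object_groupoid_def)
next
  fix e assume "e \<in> arcs G"
  then show "val_morphism (tail G e, walk_class G (tail G e) [(e, True)] (head G e), head G e) = \<kappa> e"
    using zigzag_single[of "(e, True)"]
    by (simp add: val_morphism_class letter_val_def label_closed)
qed (auto simp: one_object_groupoid_def val_morphism_class zigzag_Nil val_closed elim!: garrE)

text \<open>Induction along the walk. Functoriality reduces the claim to single edges, and the value
  on an edge traversed backwards is forced by cancellation.\<close>

lemma extends_labels_class: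
  assumes k: "extends_labels k" and "zigzag u p v"
  shows "k (u, walk_class G u p v, v) = val p"
  using assms(2)
proof (induction p arbitrary: u)
  have mor: "groupoid_morphism (free_groupoid G) (one_object_groupoid H) (\<lambda>_. ()) k"
    using k by (simp add: extends_labels_def)
  have id: "k (u, walk_class G u [] u, u) = \<one>\<^bsub>H\<^esub>" if "u \<in> verts G" for u
    using mor that by (simp add: groupoid_morphism_def one_object_groupoid_def)
  have comp: "k (u, walk_class G u (p @ q) w, w) =
      k (u, walk_class G u p v, v) \<otimes>\<^bsub>H\<^esub> k (v, walk_class G v q w, w)"
    if "zigzag u p v" "zigzag v q w" for u v w p q
  proof -
    have "\<forall>a\<in>garr (free_groupoid G). \<forall>b\<in>garr (free_groupoid G). snd (snd a) = fst b \<longrightarrow>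
        k (gcomp (free_groupoid G) a b) = k a \<otimes>\<^bsub>H\<^esub> k b"
      using mor by (simp add: groupoid_morphism_def one_object_groupoid_def)
    from this[rule_format, OF garrI[OF that(1)] garrI[OF that(2)]] show ?thesis
      by (simp add: gcomp_class[OF that])
  qed
  {
    case Nil
    then show ?case using id by (auto simp: zigzag_Nil)
  next
    case (Cons e p)
    let ?t = "tail (bar_graph G) e" and ?h = "head (bar_graph G) e"
    have e: "e \<in> bar (arcs G)" "u = ?t" "zigzag ?h p v" using Cons.prems by (simp_all add: zigzag_Cons)
    have "k (?t, walk_class G ?t [e] ?h, ?h) = letter_val e"
    proof (cases e)
      case (Pair d s)
      then have d: "d \<in> arcs G" using e(1) by simp
      let ?d = "k (tail G d, walk_class G (tail G d) [(d, True)] (head G d), head G d)"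
      let ?d' = "k (head G d, walk_class G (head G d) [(d, False)] (tail G d), tail G d)"
      have pos: "?d = \<kappa> d" using k d by (simp add: extends_labels_def)
      have z: "zigzag (tail G d) [(d, True)] (head G d)" "zigzag (head G d) [(d, False)] (tail G d)"
        using zigzag_single[of "(d, True)"] zigzag_single[of "(d, False)"] d by simp_all
      \<comment> \<open>Going back along \<open>d\<close> and then forward again is the identity
        arrow at the head of \<open>d\<close>.\<close>
      have "?d' \<otimes>\<^bsub>H\<^esub> ?d = \<one>\<^bsub>H\<^esub>"
        using comp[OF z(2,1)] walk_class_cancel[of "(d, False)"] id[of "head G d"] d
        by simp
      moreover have "?d' \<in> carrier H"
        using mor garrI[OF z(2)] by (auto simp: groupoid_morphism_def one_object_groupoid_def)
      ultimately have "?d' = inv\<^bsub>H\<^esub> \<kappa> d"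
        using pos label_closed[OF d] by (simp add: H.inv_equality)
      then show ?thesis using pos Pair by (cases s) (simp_all add: letter_val_def)
    qed
    then show ?case
      using comp[OF zigzag_single[OF e(1)] e(3)] Cons.IH[OF e(3)] e(2) by simp
  }
qed

text \<open>The morphism is determined on arrows, and membership in \<open>extensional\<close> fixes
  the function off them.\<close>

lemma extends_labels_unique:
  "\<exists>!k. k \<in> extensional (garr (free_groupoid G)) \<and> extends_labels k"
proof (rule ex1I[of _ val_morphism])
  show "val_morphism \<in> extensional (garr (free_groupoid G)) \<and> extends_labels val_morphism"
    using val_morphism_extends by (simp add: val_morphism_def)
next
  fix k assume k: "k \<in> extensional (garr (free_groupoid G)) \<and> extends_labels k"
  show "k = val_morphism"
  proof (rule extensionalityI[of _ "garr (free_groupoid G)"])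
    fix a assume "a \<in> garr (free_groupoid G)"
    then obtain u p v where "zigzag u p v" "a = (u, walk_class G u p v, v)" by (rule garrE)
    then show "k a = val_morphism a"
      using extends_labels_class[of k] k by (simp add: val_morphism_class)
  qed (use k in \<open>simp_all add: val_morphism_def\<close>)
qed

end

section \<open>Paths in the Cayley graph\<close>

context presentation
begin

lemma cayley_graph_simps [simp]:
  "verts (cayley_graph P) = carrier (grp_of P)"
  "arcs (cayley_graph P) = carrier (grp_of P) \<times> gens P"
  "tail (cayley_graph P) (g, x) = g"
  "head (cayley_graph P) (g, x) = g \<otimes>\<^bsub>grp_of P\<^esub> quot_map P (gen P x)"
  by (simp_all add: cayley_graph_def)

lemma X_class_closed: "w \<in> lists (bar (gens P)) \<Longrightarrow> X_class P w \<in> carrier (FX P)"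
  by (rule X.cl_in_carrier)

lemma X_class_append:
  "u \<in> lists (bar (gens P)) \<Longrightarrow> v \<in> lists (bar (gens P)) \<Longrightarrow>
    X_class P (u @ v) = X_class P u \<otimes>\<^bsub>FX P\<^esub> X_class P v"
  by (simp add: X.mult_cl)

lemma X_class_Cons:
  "y \<in> bar (gens P) \<Longrightarrow> v \<in> lists (bar (gens P)) \<Longrightarrow>
    X_class P (y # v) = X_class P [y] \<otimes>\<^bsub>FX P\<^esub> X_class P v"
  by (simp add: X.mult_cl)

lemma X_class_Nil: "X_class P [] = \<one>\<^bsub>FX P\<^esub>"
  by (simp add: X.one_eq)

lemma X_class_letter_inv:
  assumes "y \<in> bar (gens P)"
  shows "X_class P [letter_inv y] = inv\<^bsub>FX P\<^esub> X_class P [y]"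
proof -
  have "([letter_inv y, y], []) \<in> cancel_rules (gens P)"
    unfolding cancel_rules_def using assms by (intro image_eqI[of _ _ "letter_inv y"]) auto
  then have "X_class P [letter_inv y] \<otimes>\<^bsub>FX P\<^esub> X_class P [y] = \<one>\<^bsub>FX P\<^esub>"
    using assms by (simp add: X.mult_cl X.one_eq X.cl_rule)
  then show ?thesis
    using assms by (intro F.inv_equality[symmetric]) (simp_all add: X_class_closed)
qed

lemma gen_closed: "x \<in> gens P \<Longrightarrow> gen P x \<in> carrier (FX P)"
  by (simp add: X_class_closed)

sublocale cay: wf_digraph "cayley_graph P"
  by unfold_locales (auto simp: gen_closed)

text \<open>Joins the two clauses of \<open>lift_walk\<close>. For a negative letter the edge is
  named by its own tail, one generator before \<open>g\<close>, and is traversed backwards, so the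
  walk still leaves from \<open>g\<close>.\<close>

definition edge_at ::
    "'x free_elt set \<Rightarrow> 'x \<times> bool \<Rightarrow> ('x free_elt set \<times> 'x) \<times> bool" where
  "edge_at g y =
    ((if snd y then g else g \<otimes>\<^bsub>grp_of P\<^esub> inv\<^bsub>grp_of P\<^esub> quot_map P (gen P (fst y)), fst y), snd y)"

lemma quot_map_letter:
  assumes "x \<in> gens P"
  shows "quot_map P (X_class P [(x, False)]) = inv\<^bsub>grp_of P\<^esub> quot_map P (gen P x)"
  using X_class_letter_inv[of "(x, True)"] assms by (simp add: gen_closed)

lemma lift_walk_Cons:
  assumes "y \<in> bar (gens P)"
  shows "lift_walk P g (y # w) =
    edge_at g y # lift_walk P (g \<otimes>\<^bsub>grp_of P\<^esub> quot_map P (X_class P [y])) w"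
proof (cases y)
  case (Pair x s)
  then show ?thesis
    using assms by (cases s) (simp_all add: edge_at_def Let_def quot_map_letter)
qed

text \<open>The last claim is the reason why cancellation lifts: the inverse letter, read at the far
  end, names the same edge in the opposite direction.\<close>

lemma edge_at:
  assumes "g \<in> carrier (grp_of P)" "y \<in> bar (gens P)"
  shows "edge_at g y \<in> bar (arcs (cayley_graph P))"
    and "tail (bar_graph (cayley_graph P)) (edge_at g y) = g"
    and "head (bar_graph (cayley_graph P)) (edge_at g y) =
      g \<otimes>\<^bsub>grp_of P\<^esub> quot_map P (X_class P [y])"
    and "edge_at (g \<otimes>\<^bsub>grp_of P\<^esub> quot_map P (X_class P [y])) (letter_inv y) = letter_inv (edge_at g y)"
proof -
  obtain x s where y: "y = (x, s)" by (cases y)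
  then have x: "quot_map P (gen P x) \<in> carrier (grp_of P)" "x \<in> gens P"
    using assms by (simp_all add: gen_closed)
  then show "edge_at g y \<in> bar (arcs (cayley_graph P))"
    "tail (bar_graph (cayley_graph P)) (edge_at g y) = g"
    "head (bar_graph (cayley_graph P)) (edge_at g y) =
      g \<otimes>\<^bsub>grp_of P\<^esub> quot_map P (X_class P [y])"
    "edge_at (g \<otimes>\<^bsub>grp_of P\<^esub> quot_map P (X_class P [y])) (letter_inv y) = letter_inv (edge_at g y)"
    using assms by (cases s; simp add: y edge_at_def quot_map_letter G.m_assoc)+
qed

lemma quot_word_closed:
  "w \<in> lists (bar (gens P)) \<Longrightarrow> quot_map P (X_class P w) \<in> carrier (grp_of P)"
  by (simp add: X_class_closed)

lemma quot_word_append: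
  "u \<in> lists (bar (gens P)) \<Longrightarrow> v \<in> lists (bar (gens P)) \<Longrightarrow>
    quot_map P (X_class P (u @ v)) = quot_map P (X_class P u) \<otimes>\<^bsub>grp_of P\<^esub> quot_map P (X_class P v)"
  by (simp add: X_class_append X_class_closed)

lemma quot_word_Cons:
  "y \<in> bar (gens P) \<Longrightarrow> v \<in> lists (bar (gens P)) \<Longrightarrow>
    quot_map P (X_class P (y # v)) = quot_map P (X_class P [y]) \<otimes>\<^bsub>grp_of P\<^esub> quot_map P (X_class P v)"
  using quot_word_append[of "[y]" v] by simp

lemma lift_walk_append:
  assumes "u \<in> lists (bar (gens P))" "v \<in> lists (bar (gens P))" "g \<in> carrier (grp_of P)"
  shows "lift_walk P g (u @ v) =
    lift_walk P g u @ lift_walk P (g \<otimes>\<^bsub>grp_of P\<^esub> quot_map P (X_class P u)) v"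
  using assms(1,3)
proof (induction u arbitrary: g)
  case Nil
  then show ?case by (simp add: X_class_Nil)
next
  case (Cons y u)
  let ?y = "quot_map P (X_class P [y])" and ?u = "quot_map P (X_class P u)"
  have c: "?y \<in> carrier (grp_of P)" "?u \<in> carrier (grp_of P)"
    using Cons.hyps by (simp_all add: quot_word_closed)
  then have "lift_walk P (g \<otimes>\<^bsub>grp_of P\<^esub> ?y) (u @ v) =
      lift_walk P (g \<otimes>\<^bsub>grp_of P\<^esub> ?y) u @
      lift_walk P (g \<otimes>\<^bsub>grp_of P\<^esub> quot_map P (X_class P (y # u))) v"
    using Cons.IH[of "g \<otimes>\<^bsub>grp_of P\<^esub> ?y"] Cons.hyps Cons.prems
    by (simp add: quot_word_Cons[of y u] G.m_assoc)
  then show ?case using Cons.hyps by (simp add: lift_walk_Cons)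
qed

lemma lift_walk_zigzag:
  assumes "w \<in> lists (bar (gens P))" "g \<in> carrier (grp_of P)"
  shows "cay.zigzag g (lift_walk P g w) (g \<otimes>\<^bsub>grp_of P\<^esub> quot_map P (X_class P w))"
  using assms
proof (induction w arbitrary: g)
  case Nil
  then show ?case by (simp add: cay.zigzag_Nil X_class_Nil)
next
  case (Cons y w)
  let ?y = "quot_map P (X_class P [y])"
  have c: "?y \<in> carrier (grp_of P)" "quot_map P (X_class P w) \<in> carrier (grp_of P)"
    using Cons.hyps by (simp_all add: quot_word_closed)
  then have "cay.zigzag (g \<otimes>\<^bsub>grp_of P\<^esub> ?y) (lift_walk P (g \<otimes>\<^bsub>grp_of P\<^esub> ?y) w)
      (g \<otimes>\<^bsub>grp_of P\<^esub> quot_map P (X_class P (y # w)))"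
    using Cons.IH[of "g \<otimes>\<^bsub>grp_of P\<^esub> ?y"] Cons.hyps Cons.prems
    by (simp add: quot_word_Cons[of y w] G.m_assoc)
  then show ?case
    using Cons.hyps Cons.prems
    by (simp add: lift_walk_Cons cay.zigzag_Cons edge_at del: cayley_graph_simps)
qed

text \<open>After \<open>u\<close> the walk is at \<open>h\<close>; the cancelling pair leaves
  \<open>h\<close> along an edge and returns along the same edge, so \<open>v\<close> is lifted from
  \<open>h\<close> on both sides.\<close>

lemma lift_walk_cancel:
  assumes "rstep (bar (gens P)) (cancel_rules (gens P)) a b" "g \<in> carrier (grp_of P)"
  shows "rstep (bar (arcs (cayley_graph P))) (cancel_rules (arcs (cayley_graph P)))
    (lift_walk P g a) (lift_walk P g b)"
proof -
  obtain u v y where uv: "u \<in> lists (bar (gens P))" "v \<in> lists (bar (gens P))" "y \<in> bar (gens P)"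
      "a = u @ [y, letter_inv y] @ v" "b = u @ v"
    using assms(1) unfolding rstep_def by (auto simp del: letter_inv_simps elim!: cancel_rulesE)
  define h where "h = g \<otimes>\<^bsub>grp_of P\<^esub> quot_map P (X_class P u)"
  have h: "h \<in> carrier (grp_of P)" using assms(2) uv(1) by (simp add: h_def quot_word_closed)
  let ?y = "quot_map P (X_class P [y])"
  have y: "?y \<in> carrier (grp_of P)" using uv(3) by (simp add: quot_word_closed)
  have "h \<otimes>\<^bsub>grp_of P\<^esub> ?y \<otimes>\<^bsub>grp_of P\<^esub> quot_map P (X_class P [letter_inv y]) = h"
    using uv(3) h y by (simp add: X_class_letter_inv X_class_closed G.m_assoc)
  then have a: "lift_walk P g a =
      lift_walk P g u @ [edge_at h y, letter_inv (edge_at h y)] @ lift_walk P h v"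
    using uv assms(2) h by (simp add: lift_walk_append lift_walk_Cons edge_at flip: h_def)
  have b: "lift_walk P g b = lift_walk P g u @ [] @ lift_walk P h v"
    using uv assms(2) by (simp add: lift_walk_append flip: h_def)
  have "([edge_at h y, letter_inv (edge_at h y)], []) \<in> cancel_rules (arcs (cayley_graph P))"
    unfolding cancel_rules_def using edge_at(1)[OF h uv(3)] by blast
  then show ?thesis
    unfolding a b
    by (intro string_rewriting.rstep_context[OF free_string_rewriting]
        string_rewriting.rule_rstep[OF free_string_rewriting]
        cay.zigzag_in_lists[OF lift_walk_zigzag] uv h assms(2))
qed

text \<open>\<open>cayley_path\<close> unites the classes of the lifts of all words representing the
  element. Cancellation lifts to walks, so these classes agree and any single word may be
  used.\<close>

lemma cayley_path_class:
  assumes w: "w \<in> lists (bar (gens P))" and g: "g \<in> carrier (grp_of P)"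
  shows "cayley_path P g (X_class P w) =
    (g, walk_class (cayley_graph P) g (lift_walk P g w)
          (g \<otimes>\<^bsub>grp_of P\<^esub> quot_map P (X_class P w)),
     g \<otimes>\<^bsub>grp_of P\<^esub> quot_map P (X_class P w))"
proof -
  \<comment> \<open>The end vertex is expressed through the word as well, so that invariance under
    single cancellations concerns a function of the word alone.\<close>
  let ?f = "\<lambda>w. walk_class (cayley_graph P) g (lift_walk P g w)
    (g \<otimes>\<^bsub>grp_of P\<^esub> quot_map P (X_class P w))"
  have step: "?f a = ?f b" if "rstep (bar (gens P)) (cancel_rules (gens P)) a b" for a b
  proof -
    have ab: "a \<in> lists (bar (gens P))" "b \<in> lists (bar (gens P))"
      using X.rstep_in_lists[OF that] by simp_all
    have "X_class P a = X_class P b" using that by (simp add: X.cl_eq_iff r_into_equivclp)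
    then show ?thesis
      using lift_walk_zigzag[OF ab(1) g] lift_walk_zigzag[OF ab(2) g] lift_walk_cancel[OF that g]
      by (simp only:) (intro cay.walk_class_eq r_into_equivclp conjI)
  qed
  have "walk_class (cayley_graph P) g (lift_walk P g w')
      (g \<otimes>\<^bsub>grp_of P\<^esub> quot_map P (X_class P w)) = ?f w" if "w' \<in> X_class P w" for w'
  proof -
    have e: "X.equ w w'" using that by (simp only: X.mem_cl)
    then have "?f w = ?f w'" by (rule equivclp_invariant[OF _ step])
    moreover have "X_class P w = X_class P w'" using e by (simp only: X.cl_eq_iff)
    ultimately show ?thesis by simp
  qed
  then have "(\<Union>w'\<in>X_class P w. walk_class (cayley_graph P) g (lift_walk P g w')
      (g \<otimes>\<^bsub>grp_of P\<^esub> quot_map P (X_class P w))) = (\<Union>w'\<in>X_class P w. ?f w)"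
    by (intro SUP_cong refl)
  also have "\<dots> = ?f w" using X.self_in_cl[of w] by auto
  finally show ?thesis by (simp add: cayley_path_def Let_def)
qed

end

text \<open>Retains from the logs only that the labels lie in C(R) and have the prescribed
  boundaries. The normalisation \<open>s_one\<close> is passed on to \<open>log_derivation\<close>,
  where it makes \<open>K1\<close> a lift of boundaries.\<close>

locale cayley_labelling = presentation P
  for P :: "('x, 'r) grp_presentation" +
  fixes \<kappa> :: "'x free_elt set \<Rightarrow> 'x \<Rightarrow> ('x, 'r) C_elt"
    and s :: "'x free_elt set \<Rightarrow> 'x free_elt"
  assumes \<kappa>_closed: "g \<in> carrier (grp_of P) \<Longrightarrow> x \<in> gens P \<Longrightarrow> \<kappa> g x \<in> carrier (CR P)"
    and s_closed: "g \<in> carrier (grp_of P) \<Longrightarrow> s g \<in> carrier (FX P)"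
    and s_one: "s \<one>\<^bsub>grp_of P\<^esub> = \<one>\<^bsub>FX P\<^esub>"
    and delta2_\<kappa>: "g \<in> carrier (grp_of P) \<Longrightarrow> x \<in> gens P \<Longrightarrow>
      delta2 P (\<kappa> g x) = s g \<otimes>\<^bsub>FX P\<^esub> gen P x \<otimes>\<^bsub>FX P\<^esub>
        inv\<^bsub>FX P\<^esub> s (g \<otimes>\<^bsub>grp_of P\<^esub> quot_map P (gen P x))"
begin

sublocale lab: edge_labelling "cayley_graph P" "CR P" "\<lambda>(g, x). \<kappa> g x"
  by unfold_locales (auto simp: \<kappa>_closed)

lemma cayley_path_gen:
  assumes "g \<in> carrier (grp_of P)" "x \<in> gens P"
  shows "cayley_path P g (gen P x) =
    (g, walk_class (cayley_graph P) g [((g, x), True)] (g \<otimes>\<^bsub>grp_of P\<^esub> quot_map P (gen P x)),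
     g \<otimes>\<^bsub>grp_of P\<^esub> quot_map P (gen P x))"
  using cayley_path_class[of "[(x, True)]" g] assms by simp

lemma extends_edge_map_iff: "extends_edge_map P \<kappa> k \<longleftrightarrow> lab.extends_labels k"
  unfolding extends_edge_map_def lab.extends_labels_def by (simp add: cayley_path_gen)

lemma extends_edge_map_unique:
  "\<exists>!k. k \<in> extensional (garr (free_groupoid (cayley_graph P))) \<and> extends_edge_map P \<kappa> k"
  unfolding extends_edge_map_iff by (rule lab.extends_labels_unique)

lemma extends_edge_map_path:
  assumes "extends_edge_map P \<kappa> k" "w \<in> lists (bar (gens P))" "g \<in> carrier (grp_of P)"
  shows "k (cayley_path P g (X_class P w)) = lab.val (lift_walk P g w)"
  using assms lab.extends_labels_class[of k, OF _ lift_walk_zigzag]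
  by (simp add: cayley_path_class extends_edge_map_iff)

lemma delta2_letter:
  assumes g: "g \<in> carrier (grp_of P)" and y: "y \<in> bar (gens P)"
  shows "delta2 P (lab.letter_val (edge_at g y)) = s g \<otimes>\<^bsub>FX P\<^esub> X_class P [y] \<otimes>\<^bsub>FX P\<^esub>
    inv\<^bsub>FX P\<^esub> s (g \<otimes>\<^bsub>grp_of P\<^esub> quot_map P (X_class P [y]))"
proof (cases y)
  case (Pair x e)
  have x: "x \<in> gens P" using y Pair by simp
  let ?x = "quot_map P (gen P x)"
  have xG: "?x \<in> carrier (grp_of P)" using x by (simp add: gen_closed)
  show ?thesis
  proof (cases e)
    case True
    then show ?thesis using Pair g x by (simp add: lab.letter_val_def edge_at_def delta2_\<kappa>)
  next
    case False
    \<comment> \<open>The edge traversed runs from \<open>h\<close> to \<open>g\<close> and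
      contributes the inverse of its label, so inverting its boundary exchanges the roles of
      \<open>s h\<close> and \<open>s g\<close>.\<close>
    define h where "h = g \<otimes>\<^bsub>grp_of P\<^esub> inv\<^bsub>grp_of P\<^esub> ?x"
    have h: "h \<in> carrier (grp_of P)" "h \<otimes>\<^bsub>grp_of P\<^esub> ?x = g"
      using g xG by (simp_all add: h_def G.m_assoc)
    have "delta2 P (inv\<^bsub>CR P\<^esub> \<kappa> h x) =
        inv\<^bsub>FX P\<^esub> (s h \<otimes>\<^bsub>FX P\<^esub> gen P x \<otimes>\<^bsub>FX P\<^esub> inv\<^bsub>FX P\<^esub> s g)"
      using h x by (simp add: \<kappa>_closed delta2_\<kappa>)
    also have "\<dots> = s g \<otimes>\<^bsub>FX P\<^esub> X_class P [y] \<otimes>\<^bsub>FX P\<^esub> inv\<^bsub>FX P\<^esub> s h"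
      using s_closed[OF g] s_closed[OF h(1)] x X_class_letter_inv[of "(x, True)"] Pair False
      by (simp add: gen_closed F.inv_mult_group F.m_assoc)
    finally show ?thesis
      using Pair False x
      by (simp add: lab.letter_val_def edge_at_def quot_map_letter flip: h_def)
  qed
qed

text \<open>The boundaries of the letters telescope: at each intermediate vertex \<open>h\<close>
  the factor \<open>inv (s h)\<close> meets \<open>s h\<close>.\<close>

lemma delta2_val:
  assumes "w \<in> lists (bar (gens P))" "g \<in> carrier (grp_of P)"
  shows "delta2 P (lab.val (lift_walk P g w)) = s g \<otimes>\<^bsub>FX P\<^esub> X_class P w \<otimes>\<^bsub>FX P\<^esub>
    inv\<^bsub>FX P\<^esub> s (g \<otimes>\<^bsub>grp_of P\<^esub> quot_map P (X_class P w))"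
  using assms
proof (induction w arbitrary: g)
  case Nil
  then show ?case by (simp add: X_class_Nil s_closed)
next
  case (Cons y w)
  define h where "h = g \<otimes>\<^bsub>grp_of P\<^esub> quot_map P (X_class P [y])"
  define h' where "h' = g \<otimes>\<^bsub>grp_of P\<^esub> quot_map P (X_class P (y # w))"
  have c: "quot_map P (X_class P [y]) \<in> carrier (grp_of P)"
    "quot_map P (X_class P w) \<in> carrier (grp_of P)"
    using Cons.hyps by (simp_all add: quot_word_closed)
  have h: "h \<in> carrier (grp_of P)" "h' \<in> carrier (grp_of P)"
    "h \<otimes>\<^bsub>grp_of P\<^esub> quot_map P (X_class P w) = h'"
    using c Cons.hyps Cons.prems by (simp_all add: h_def h'_def quot_word_Cons[of y w] G.m_assoc)
  have X: "X_class P [y] \<in> carrier (FX P)" "X_class P w \<in> carrier (FX P)"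
    using Cons.hyps by (simp_all add: X_class_closed)
  have "delta2 P (lab.val (lift_walk P g (y # w))) =
      delta2 P (lab.letter_val (edge_at g y)) \<otimes>\<^bsub>FX P\<^esub> delta2 P (lab.val (lift_walk P h w))"
    using Cons.hyps h Cons.prems Pi_mem[OF lab.letter_val_closed edge_at(1)]
      lab.val_closed[OF lift_walk_zigzag]
    by (simp add: lift_walk_Cons flip: h_def)
  also have "\<dots> = (s g \<otimes>\<^bsub>FX P\<^esub> X_class P [y] \<otimes>\<^bsub>FX P\<^esub> inv\<^bsub>FX P\<^esub> s h) \<otimes>\<^bsub>FX P\<^esub>
      (s h \<otimes>\<^bsub>FX P\<^esub> X_class P w \<otimes>\<^bsub>FX P\<^esub> inv\<^bsub>FX P\<^esub> s h')"
    using delta2_letter[OF Cons.prems Cons.hyps(1)] Cons.IH[OF h(1)] h(3)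
    by (simp only: h_def[symmetric])
  also have "\<dots> = s g \<otimes>\<^bsub>FX P\<^esub> X_class P [y] \<otimes>\<^bsub>FX P\<^esub> X_class P w \<otimes>\<^bsub>FX P\<^esub> inv\<^bsub>FX P\<^esub> s h'"
  proof -
    have "inv\<^bsub>FX P\<^esub> s h \<otimes>\<^bsub>FX P\<^esub> (s h \<otimes>\<^bsub>FX P\<^esub> z) = z" if "z \<in> carrier (FX P)" for z
      using that s_closed[OF h(1)] by (simp flip: F.m_assoc)
    then show ?thesis
      using X s_closed[OF Cons.prems] s_closed[OF h(1)] s_closed[OF h(2)] by (simp add: F.m_assoc)
  qed
  also have "\<dots> = s g \<otimes>\<^bsub>FX P\<^esub> X_class P (y # w) \<otimes>\<^bsub>FX P\<^esub> inv\<^bsub>FX P\<^esub> s h'"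
    using X s_closed[OF Cons.prems] Cons.hyps by (simp add: X_class_Cons[of y w] F.m_assoc)
  finally show ?case by (simp only: h'_def)
qed

text \<open>Links the Cayley graph to the generation argument. The product law holds because the
  lift of a concatenation is the concatenation of lifts and \<open>lab.val\<close> is multiplicative
  along it.\<close>

lemma log_derivation_path:
  assumes k: "extends_edge_map P \<kappa> k"
  shows "log_derivation P s (\<lambda>g u. k (cayley_path P g u))"
proof
  fix g u assume g: "g \<in> carrier (grp_of P)" and u: "u \<in> carrier (FX P)"
  obtain w where w: "w \<in> lists (bar (gens P))" "u = X_class P w" using u by (rule X.carrierE)
  show "k (cayley_path P g u) \<in> carrier (CR P)"
    using extends_edge_map_path[OF k w(1) g] lab.val_closed[OF lift_walk_zigzag[OF w(1) g]]
    by (simp add: w(2))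
  show "delta2 P (k (cayley_path P g u)) =
      s g \<otimes>\<^bsub>FX P\<^esub> u \<otimes>\<^bsub>FX P\<^esub> inv\<^bsub>FX P\<^esub> s (g \<otimes>\<^bsub>grp_of P\<^esub> quot_map P u)"
    using extends_edge_map_path[OF k w(1) g] delta2_val[OF w(1) g] by (simp add: w(2))
  fix v assume v: "v \<in> carrier (FX P)"
  obtain z where z: "z \<in> lists (bar (gens P))" "v = X_class P z" using v by (rule X.carrierE)
  have h: "g \<otimes>\<^bsub>grp_of P\<^esub> quot_map P u \<in> carrier (grp_of P)" using g u by simp
  show "k (cayley_path P g (u \<otimes>\<^bsub>FX P\<^esub> v)) =
      k (cayley_path P g u) \<otimes>\<^bsub>CR P\<^esub> k (cayley_path P (g \<otimes>\<^bsub>grp_of P\<^esub> quot_map P u) v)"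
    using w z g h lab.val_append[OF lift_walk_zigzag[OF w(1) g] lift_walk_zigzag[OF z(1) h[unfolded w(2)]]]
    by (simp add: extends_edge_map_path[OF k] lift_walk_append flip: X_class_append)
qed (simp_all add: s_closed s_one)

end

section \<open>Complete logged rewrite systems\<close>

locale complete_logged = presentation P
  for P :: "('x, 'r) grp_presentation" +
  fixes L :: "('x, 'r) logged_rule set"
  assumes complete: "complete_logged_rewrite_system P L"
begin

abbreviation red :: "('x \<times> bool) list \<Rightarrow> ('x \<times> bool) list \<Rightarrow> bool" where
  "red \<equiv> rstep (bar (gens P)) (rules_of L)"

abbreviation irred :: "('x \<times> bool) list \<Rightarrow> bool" where
  "irred \<equiv> irreducible_word (bar (gens P)) (rules_of L)"

lemma rules: "rules_of L \<subseteq> lists (bar (gens P)) \<times> lists (bar (gens P))"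
  using complete
  by (simp add: complete_logged_rewrite_system_def logged_rewrite_system_def
      rewriting_system_for_def)

sublocale S: string_rewriting "bar (gens P)" "rules_of L"
  by unfold_locales (rule rules)

lemma wfp_red: "wfp red\<inverse>\<inverse>" and confluent_red: "confluentp red"
  using complete by (simp_all add: complete_logged_rewrite_system_def complete_rewriting_def)

lemma rule_log:
  assumes "(l, c, r) \<in> L"
  shows "c \<in> lists (Ybar P)" "X_class P l = delta P c \<otimes>\<^bsub>FX P\<^esub> X_class P r"
    "l \<in> lists (bar (gens P))" "r \<in> lists (bar (gens P))"
proof -
  show "c \<in> lists (Ybar P)" "X_class P l = delta P c \<otimes>\<^bsub>FX P\<^esub> X_class P r"
    using complete assms
    by (auto simp: complete_logged_rewrite_system_def logged_rewrite_system_def)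
  have "(l, r) \<in> rules_of L"
    unfolding rules_of_def using assms by (intro image_eqI[of _ _ "(l, c, r)"]) simp_all
  then show "l \<in> lists (bar (gens P))" "r \<in> lists (bar (gens P))" using rules by auto
qed

text \<open>This is injectivity of the isomorphism onto G that comes with a rewriting system for the
  presentation.\<close>

lemma quot_eq_iff:
  assumes "a \<in> lists (bar (gens P))" "b \<in> lists (bar (gens P))"
  shows "quot_map P (X_class P a) = quot_map P (X_class P b) \<longleftrightarrow> S.equ a b"
proof -
  obtain h where h: "h \<in> iso S.M (grp_of P)"
      "\<And>w. w \<in> lists (bar (gens P)) \<Longrightarrow> h (S.cl w) = quot_map P (X_class P w)"
    using complete
    by (auto simp: complete_logged_rewrite_system_def logged_rewrite_system_def
        rewriting_system_for_def)
  have "inj_on h (carrier S.M)" using h(1) by (simp add: iso_def bij_betw_def)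
  then have "h (S.cl a) = h (S.cl b) \<longleftrightarrow> S.cl a = S.cl b"
    using S.cl_in_carrier[OF assms(1)] S.cl_in_carrier[OF assms(2)] by (rule inj_on_eq_iff)
  then show ?thesis using h(2)[OF assms(1)] h(2)[OF assms(2)] by (simp only: S.cl_eq_iff)
qed

section \<open>Normal forms and the section of the quotient map\<close>

lemma normal_form_exists: "\<exists>z. red\<^sup>*\<^sup>* w z \<and> irred z"
proof (induction w rule: wfp_induct_rule[OF wfp_red])
  case (1 w)
  show ?case
  proof (cases "irred w")
    case False
    then obtain z where z: "red w z" by (auto simp: irreducible_word_def)
    then obtain y where "red\<^sup>*\<^sup>* z y" "irred y" using 1[of z] by auto
    then show ?thesis using z converse_rtranclp_into_rtranclp[of red w z y] by blast
  qed blast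
qed

lemma red_star_in_lists:
  "red\<^sup>*\<^sup>* w z \<Longrightarrow> w \<in> lists (bar (gens P)) \<Longrightarrow> z \<in> lists (bar (gens P))"
  using S.equ_in_lists[OF rtranclp_into_equivclp] by blast

lemma irred_red_star: "irred w \<Longrightarrow> red\<^sup>*\<^sup>* w z \<Longrightarrow> z = w"
  by (erule converse_rtranclpE) (auto simp: irreducible_word_def)

text \<open>By confluence equivalent words have a common reduct, and an irreducible word is its only
  reduct.\<close>

lemma irred_unique:
  assumes "S.equ a b" "irred a" "irred b"
  shows "a = b"
proof -
  have "(red\<^sup>*\<^sup>* OO red\<inverse>\<inverse>\<^sup>*\<^sup>*) a b"
    using assms(1) semiconfluentp_equivclp[OF confluentp_imp_semiconfluentp[OF confluent_red]]
    by simp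
  then obtain z where "red\<^sup>*\<^sup>* a z" "red\<^sup>*\<^sup>* b z" by (auto simp: rtranclp_conversep)
  then show ?thesis using assms irred_red_star by blast
qed

text \<open>A rule with empty left side would apply to every word over the alphabet, so none would
  be minimal, against termination. This is what makes the section send 1 to 1.\<close>

lemma irred_Nil: "irred []"
proof (rule ccontr)
  assume "\<not> irred []"
  then obtain r where r: "([], r) \<in> rules_of L" by (auto simp: irreducible_word_def rstep_def)
  have "red z (r @ z)" if "z \<in> lists (bar (gens P))" for z
    using S.rstep_context[OF S.rule_rstep[OF r], of "[]" z] that by simp
  moreover have "r \<in> lists (bar (gens P))" using r rules by auto
  moreover obtain z where "z \<in> lists (bar (gens P))"
      "\<And>y. red z y \<Longrightarrow> y \<notin> lists (bar (gens P))"
    using wfp_red[unfolded wfp_iff_ex_minimal, rule_format, of "lists (bar (gens P))"] by auto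
  ultimately show False by (metis append_in_lists_conv)
qed

text \<open>Reducing any representing word gives existence and confluence gives uniqueness; together
  they justify the definite description in \<open>sect\<close>.\<close>

lemma sect_ex1:
  assumes "g \<in> carrier (grp_of P)"
  shows "\<exists>!w. w \<in> lists (bar (gens P)) \<and> irred w \<and> quot_map P (X_class P w) = g"
proof -
  obtain u where u: "u \<in> carrier (FX P)" "g = quot_map P u" using assms by (rule grp_ofE)
  obtain w where w: "w \<in> lists (bar (gens P))" "u = X_class P w" using u(1) by (rule X.carrierE)
  obtain z where z: "red\<^sup>*\<^sup>* w z" "irred z" using normal_form_exists by blast
  have zl: "z \<in> lists (bar (gens P))" using z(1) w(1) by (rule red_star_in_lists)
  have "quot_map P (X_class P z) = g"
    using quot_eq_iff[OF w(1) zl] rtranclp_into_equivclp[OF z(1)] u(2) w(2) by simp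
  then show ?thesis
    using z zl quot_eq_iff irred_unique by (intro ex1I[of _ z]) auto
qed

lemma sect_props:
  assumes "g \<in> carrier (grp_of P)"
  shows "sect P L g \<in> carrier (FX P)" "quot_map P (sect P L g) = g"
  using theI'[OF sect_ex1[OF assms]] by (simp_all add: sect_def X_class_closed)

lemma sect_one: "sect P L \<one>\<^bsub>grp_of P\<^esub> = \<one>\<^bsub>FX P\<^esub>"
proof -
  have "(THE w. w \<in> lists (bar (gens P)) \<and> irred w \<and> quot_map P (X_class P w) = \<one>\<^bsub>grp_of P\<^esub>) = []"
    using sect_ex1[of "\<one>\<^bsub>grp_of P\<^esub>"] irred_Nil by (intro the1_equality) (simp_all add: X_class_Nil)
  then show ?thesis by (simp add: sect_def X_class_Nil)
qed

text \<open>The boundary of the log times the current word is the invariant of a logged reduction. A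
  rule contributes its boundary \<open>D'\<close> behind the prefix \<open>U\<close>; the exponent
  \<open>inv U\<close> on the appended log conjugates \<open>D'\<close> so that it can stand in
  front of \<open>U\<close>.\<close>

lemma logged_step_delta:
  assumes "logged_step P L (w, d) (z, c)" "w \<in> lists (bar (gens P))" "d \<in> lists (Ybar P)"
  shows "z \<in> lists (bar (gens P)) \<and> c \<in> lists (Ybar P) \<and>
    delta P d \<otimes>\<^bsub>FX P\<^esub> X_class P w = delta P c \<otimes>\<^bsub>FX P\<^esub> X_class P z"
proof -
  obtain u v l c' r where s: "u \<in> lists (bar (gens P))" "v \<in> lists (bar (gens P))" "(l, c', r) \<in> L"
      "w = u @ l @ v" "z = u @ r @ v" "c = d @ Yseq_act P c' (inv\<^bsub>FX P\<^esub> (X_class P u))"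
    using assms(1) unfolding logged_step_def by auto
  note rl = rule_log[OF s(3)]
  define U where "U = X_class P u"
  define V where "V = X_class P v"
  define R where "R = X_class P r"
  define D where "D = delta P d"
  define D' where "D' = delta P c'"
  have closed: "U \<in> carrier (FX P)" "V \<in> carrier (FX P)" "R \<in> carrier (FX P)"
    "D \<in> carrier (FX P)" "D' \<in> carrier (FX P)"
    using s rl assms(3) by (simp_all add: U_def V_def R_def D_def D'_def X_class_closed delta_closed)
  have act: "Yseq_act P c' (inv\<^bsub>FX P\<^esub> U) \<in> lists (Ybar P)"
    using rl(1) closed by (simp add: Yseq_act_closed)
  have w: "X_class P w = U \<otimes>\<^bsub>FX P\<^esub> (D' \<otimes>\<^bsub>FX P\<^esub> R \<otimes>\<^bsub>FX P\<^esub> V)"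
    using s rl by (simp add: X_class_append U_def V_def R_def D'_def)
  have z: "X_class P z = U \<otimes>\<^bsub>FX P\<^esub> (R \<otimes>\<^bsub>FX P\<^esub> V)"
    using s rl by (simp add: X_class_append U_def V_def R_def)
  have c: "delta P c = D \<otimes>\<^bsub>FX P\<^esub> (U \<otimes>\<^bsub>FX P\<^esub> D' \<otimes>\<^bsub>FX P\<^esub> inv\<^bsub>FX P\<^esub> U)"
    using s(6) assms(3) act rl(1) closed
    by (simp add: delta_append delta_act D_def D'_def flip: U_def)
  have "inv\<^bsub>FX P\<^esub> U \<otimes>\<^bsub>FX P\<^esub> (U \<otimes>\<^bsub>FX P\<^esub> x) = x" if "x \<in> carrier (FX P)" for x
    using that closed by (simp flip: F.m_assoc)
  then have "D \<otimes>\<^bsub>FX P\<^esub> X_class P w = delta P c \<otimes>\<^bsub>FX P\<^esub> X_class P z"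
    using closed by (simp add: w z c F.m_assoc)
  then show ?thesis using s rl assms(3) act by (simp add: D_def flip: U_def)
qed

lemma logged_steps_delta:
  assumes "(logged_step P L)\<^sup>*\<^sup>* s t"
    and "fst s \<in> lists (bar (gens P))" "snd s \<in> lists (Ybar P)"
  shows "fst t \<in> lists (bar (gens P)) \<and> snd t \<in> lists (Ybar P) \<and>
    delta P (snd s) \<otimes>\<^bsub>FX P\<^esub> X_class P (fst s) = delta P (snd t) \<otimes>\<^bsub>FX P\<^esub> X_class P (fst t)"
  using assms(1)
proof induction
  case base
  then show ?case using assms by simp
next
  case (step t t')
  then show ?case using logged_step_delta[of "fst t" "snd t" "fst t'" "snd t'"] by simp
qed

text \<open>Every pair in \<open>rules_of L\<close> comes from a logged rule, so each rewriting step
  can be accompanied by a log, whatever has been recorded before.\<close>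

lemma logged_steps_exist:
  assumes "red\<^sup>*\<^sup>* w z"
  shows "\<exists>c. (logged_step P L)\<^sup>*\<^sup>* (w, d) (z, c)"
  using assms
proof induction
  case (step y z)
  then obtain c where c: "(logged_step P L)\<^sup>*\<^sup>* (w, d) (y, c)" by blast
  obtain u v l c' r where s: "u \<in> lists (bar (gens P))" "v \<in> lists (bar (gens P))" "(l, c', r) \<in> L"
      "y = u @ l @ v" "z = u @ r @ v"
    using step.hyps(2) unfolding rstep_def rules_of_def by auto
  then have "logged_step P L (y, c) (z, c @ Yseq_act P c' (inv\<^bsub>FX P\<^esub> (X_class P u)))"
    unfolding logged_step_def by (intro bexI[of _ u] bexI[of _ v] bexI[of _ "(l, c', r)"]) simp_all
  with c show ?case by (meson rtranclp.rtrancl_into_rtrancl)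
qed blast

lemma is_log_exists: "\<exists>c. is_log P L w c"
  using normal_form_exists[of w] logged_steps_exist unfolding is_log_def by blast

text \<open>The boundary of a log is trivial in G, so the terminal word represents the same element
  as \<open>w\<close>, namely 1. Being irreducible it is empty, and the invariant of the reduction
  leaves only the boundary.\<close>

lemma is_log_delta:
  assumes log: "is_log P L w c" and w: "w \<in> lists (bar (gens P))"
    and one: "quot_map P (X_class P w) = \<one>\<^bsub>grp_of P\<^esub>"
  shows "c \<in> lists (Ybar P)" "delta P c = X_class P w"
proof -
  obtain z where z: "(logged_step P L)\<^sup>*\<^sup>* (w, []) (z, c)" "irred z"
    using log unfolding is_log_def by blast
  have *: "z \<in> lists (bar (gens P))" "c \<in> lists (Ybar P)"
    "X_class P w = delta P c \<otimes>\<^bsub>FX P\<^esub> X_class P z"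
    using logged_steps_delta[OF z(1)] w by (simp_all add: delta_Nil X_class_closed)
  have "quot_map P (X_class P w) = quot_map P (X_class P z)"
    using * quot_map_delta[OF C_class_closed[OF *(2)]] quot_word_closed[OF *(1)]
    by (simp add: delta2_class delta_closed X_class_closed)
  then have "S.equ z []"
    using one quot_eq_iff[OF *(1), of "[]"] by (simp add: X_class_Nil)
  then have "z = []" using z(2) irred_Nil by (rule irred_unique)
  then show "c \<in> lists (Ybar P)" "delta P c = X_class P w"
    using * by (simp_all add: X_class_Nil delta_closed)
qed

lemma quot_edge_elt:
  assumes "g \<in> carrier (grp_of P)" "x \<in> gens P"
  shows "quot_map P (edge_elt P L g x) = \<one>\<^bsub>grp_of P\<^esub>"
  using assms by (simp add: edge_elt_def sect_props gen_closed)

text \<open>For each edge the trivial class is chosen if some log has it, and the class of any log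
  otherwise.\<close>

lemma edge_logs_exist: "\<exists>\<kappa>. edge_logs P L w \<kappa>"
proof -
  have "\<exists>k. (\<exists>c. is_log P L (w g x) c \<and> k = C_class P c) \<and>
      ((\<exists>c. is_log P L (w g x) c \<and> C_class P c = C_class P []) \<longrightarrow> k = C_class P [])" for g x
    using is_log_exists[of "w g x"] by metis
  then have "\<exists>\<kappa>. \<forall>g x. (\<exists>c. is_log P L (w g x) c \<and> \<kappa> g x = C_class P c) \<and>
      ((\<exists>c. is_log P L (w g x) c \<and> C_class P c = C_class P []) \<longrightarrow> \<kappa> g x = C_class P [])"
    by (intro choice allI)
  then show ?thesis unfolding edge_logs_def by blast
qed

text \<open>An edge word represents 1 in G, so by \<open>is_log_delta\<close> each of its logs has
  the edge element itself as boundary.\<close>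

lemma cayley_labelling_logs:
  assumes w: "edge_words P L w" and \<kappa>: "edge_logs P L w \<kappa>"
  shows "cayley_labelling P \<kappa> (sect P L)"
proof
  fix g x assume g: "g \<in> carrier (grp_of P)" and x: "x \<in> gens P"
  obtain c where c: "is_log P L (w g x) c" "\<kappa> g x = C_class P c"
    using \<kappa> g x unfolding edge_logs_def by blast
  have wl: "w g x \<in> lists (bar (gens P))" "X_class P (w g x) = edge_elt P L g x"
    using w g x unfolding edge_words_def by blast+
  have "c \<in> lists (Ybar P)" "delta P c = edge_elt P L g x"
    using is_log_delta[OF c(1) wl(1)] quot_edge_elt[OF g x] wl(2) by simp_all
  then show "\<kappa> g x \<in> carrier (CR P)"
    "delta2 P (\<kappa> g x) = sect P L g \<otimes>\<^bsub>FX P\<^esub> gen P x \<otimes>\<^bsub>FX P\<^esub>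
        inv\<^bsub>FX P\<^esub> sect P L (g \<otimes>\<^bsub>grp_of P\<^esub> quot_map P (gen P x))"
    by (simp_all add: c(2) C_class_closed delta2_class edge_elt_def)
qed (simp_all add: sect_props sect_one)

end

text \<open>Reductions, and hence logs, involve choices, so the existence of a choice is stated on
  its own and the remaining claims hold for each \<open>\<kappa>\<close>. Uniqueness of
  \<open>k1\<close> is among extensional functions, as only its values on arrows carry
  meaning.\<close>

theorem mainTheorem1:
  fixes P :: "('x, 'r) grp_presentation"
    and L :: "('x, 'r) logged_rule set"
    and w :: "'x free_elt set \<Rightarrow> 'x \<Rightarrow> ('x \<times> bool) list"
  assumes "is_presentation P"
    and "complete_logged_rewrite_system P L"
    and "edge_words P L w"
  shows "(\<exists>\<kappa>. edge_logs P L w \<kappa>) \<and>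
    (\<forall>\<kappa>. edge_logs P L w \<kappa> \<longrightarrow>
       (\<exists>!k1. k1 \<in> extensional (garr (free_groupoid (cayley_graph P))) \<and>
              extends_edge_map P \<kappa> k1) \<and>
       (\<forall>k1. extends_edge_map P \<kappa> k1 \<longrightarrow>
          (\<forall>g\<in>carrier (grp_of P). \<forall>x\<in>gens P.
             delta2 P (k1 (cayley_path P g (gen P x))) =
               sect P L g \<otimes>\<^bsub>FX P\<^esub> gen P x \<otimes>\<^bsub>FX P\<^esub>
               inv\<^bsub>FX P\<^esub> (sect P L (g \<otimes>\<^bsub>grp_of P\<^esub> quot_map P (gen P x)))) \<and>
          generates_Pi2 P {identity_gen P L k1 g \<rho> | g \<rho>. g \<in> carrier (grp_of P) \<and> \<rho> \<in> labels P}))"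
proof (intro conjI allI impI)
  interpret complete_logged P L by unfold_locales (fact assms)+
  show "\<exists>\<kappa>. edge_logs P L w \<kappa>" by (rule edge_logs_exist)
  fix \<kappa> assume "edge_logs P L w \<kappa>"
  then interpret cayley_labelling P \<kappa> "sect P L"
    by (rule cayley_labelling_logs[OF assms(3)])
  show "\<exists>!k1. k1 \<in> extensional (garr (free_groupoid (cayley_graph P))) \<and> extends_edge_map P \<kappa> k1"
    by (rule extends_edge_map_unique)
  fix k1 assume "extends_edge_map P \<kappa> k1"
  \<comment> \<open>From here the abstract argument applies: for this instance \<open>D.iota\<close>
    is \<open>identity_gen\<close>.\<close>
  then interpret D: log_derivation P "sect P L" "\<lambda>g u. k1 (cayley_path P g u)"
    by (rule log_derivation_path)
  show "\<forall>g\<in>carrier (grp_of P). \<forall>x\<in>gens P.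
      delta2 P (k1 (cayley_path P g (gen P x))) =
        sect P L g \<otimes>\<^bsub>FX P\<^esub> gen P x \<otimes>\<^bsub>FX P\<^esub>
        inv\<^bsub>FX P\<^esub> (sect P L (g \<otimes>\<^bsub>grp_of P\<^esub> quot_map P (gen P x)))"
    by (intro ballI D.delta2_K gen_closed)
  show "generates_Pi2 P {identity_gen P L k1 g \<rho> | g \<rho>. g \<in> carrier (grp_of P) \<and> \<rho> \<in> labels P}"
    using D.iota_generates_Pi2 by (simp only: D.iota_def identity_gen_def)
qed

end
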